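(* The following hold. (1) Let $r\geq 2$ and $\Delta\geq 1$ be integers. If $r=2$, or if $\Delta=2$ and $r\notin\{3,5\}$, then $f(r,\Delta)=\Delta+1$. (2) There are absolute positive constants $c, c_0$ such that for all positive integers $r,\Delta$ with $r\geq c$ and $\Delta\geq c_0\ln r$, $f(r,\Delta)\leq \Delta$. (3) If $\Delta\geq 3$ is an integer, then $f(4,\Delta)\leq\Delta$.
   Context: A hypergraph $\mathcal{H}=(V,\mathcal{E})$ consists of a finite nonempty vertex set $V$ and a set $\mathcal{E}$ of nonempty subsets of $V$, called edges or hyperedges. It is $r$-uniform if each edge contains exactly $r$ vertices. The degree of a vertex is the number of edges containing it, and the maximum degree $\Delta(\mathcal{H})$ is the largest degree of a vertex. A vertex coloring of $\mathcal{H}$ is conflict-free if each edge $E$ contains a vertex whose color is assigned to no other vertex of $E$. The conflict-free chromatic number $\chi_{\mathrm{cf}}(\mathcal{H})$ is the minimum number of colors used in a conflict-free coloring of $\mathcal{H}$. Define $$f(r,\Delta)=\max\{\chi_{\mathrm{cf}}(\mathcal{H}) : \mathcal{H} \text{ is an } r\text{-uniform hypergraph with } \Delta(\mathcal{H})=\Delta\}.$$ *)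

theory Defs
  imports Complex_Main
begin

definition hypergraph :: "'a set \<Rightarrow> 'a set set \<Rightarrow> bool" where
  "hypergraph V E \<longleftrightarrow> finite V \<and> V \<noteq> {} \<and> (\<forall>e\<in>E. e \<subseteq> V \<and> e \<noteq> {})"

definition uniform_edges :: "nat \<Rightarrow> 'a set set \<Rightarrow> bool" where
  "uniform_edges r E \<longleftrightarrow> (\<forall>e\<in>E. card e = r)"

definition vertex_degree :: "'a set set \<Rightarrow> 'a \<Rightarrow> nat" where
  "vertex_degree E v = card {e\<in>E. v \<in> e}"

definition max_degree :: "'a set \<Rightarrow> 'a set set \<Rightarrow> nat" where
  "max_degree V E = Max (vertex_degree E ` V)"

definition conflict_free :: "'a set set \<Rightarrow> ('a \<Rightarrow> nat) \<Rightarrow> bool" where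
  "conflict_free E col \<longleftrightarrow> (\<forall>e\<in>E. \<exists>v\<in>e. \<forall>w\<in>e. w \<noteq> v \<longrightarrow> col w \<noteq> col v)"

definition chi_cf :: "'a set \<Rightarrow> 'a set set \<Rightarrow> nat" where
  "chi_cf V E = (LEAST k. \<exists>col. conflict_free E col \<and> card (col ` V) = k)"

text \<open>Vertices are taken to be natural numbers. This loses no generality, since every
  hypergraph is finite; see \<open>chi_cf_in_cf_values\<close> below.\<close>

definition cf_values :: "nat \<Rightarrow> nat \<Rightarrow> nat set" where
  "cf_values r \<Delta> = {chi_cf V E | (V :: nat set) E.
     hypergraph V E \<and> uniform_edges r E \<and> max_degree V E = \<Delta>}"

text \<open>\<^const>\<open>Max\<close> is unspecified on infinite and empty sets. The lemmas
  \<open>finite_cf_values\<close> and \<open>cf_values_nonempty\<close> below show that neither occurs for \<open>r \<ge> 2\<close>.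
  For \<open>r = 1\<close> the set is empty if \<open>\<Delta> \<ge> 2\<close>.\<close>

definition f_cf :: "nat \<Rightarrow> nat \<Rightarrow> nat" where
  "f_cf r \<Delta> = Max (cf_values r \<Delta>)"

lemma finite_edges:
  assumes "hypergraph V E"
  shows "finite E"
proof -
  have "E \<subseteq> Pow V" "finite (Pow V)" using assms by (auto simp: hypergraph_def)
  then show ?thesis by (rule finite_subset)
qed

lemma chi_cf_le:
  assumes "conflict_free E col"
  shows "chi_cf V E \<le> card (col ` V)"
  unfolding chi_cf_def using assms by (intro Least_le) blast

lemma degree_le_max_degree:
  assumes "hypergraph V E" "v \<in> V"
  shows "vertex_degree E v \<le> max_degree V E"
  unfolding max_degree_def using assms by (auto simp: hypergraph_def intro!: Max_ge)

lemma ex_rainbow_coloring: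
  assumes H: "hypergraph V E" "uniform_edges r E" and "finite S" "S \<subseteq> V"
  shows "\<exists>col. col ` S \<subseteq> {..max_degree V E * r} \<and> (\<forall>e\<in>E. inj_on col (e \<inter> S))"
  using assms(3,4)
proof (induction S rule: finite_induct)
  case empty
  then show ?case by auto
next
  case (insert v S)
  then obtain col where col: "col ` S \<subseteq> {..max_degree V E * r}"
    "\<And>e. e \<in> E \<Longrightarrow> inj_on col (e \<inter> S)" by auto
  let ?F = "{e\<in>E. v \<in> e}"
  have finF: "finite ?F" using finite_edges[OF H(1)] by simp
  have fine: "finite e" if "e \<in> E" for e
    using H(1) that by (auto simp: hypergraph_def intro: finite_subset)
  have "card (\<Union>?F) \<le> (\<Sum>e\<in>?F. card e)"
    by (rule card_Union_le_sum_card)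
  also have "\<dots> = card ?F * r"
    using H(2) by (simp add: uniform_edges_def)
  also have "\<dots> \<le> max_degree V E * r"
    using degree_le_max_degree[OF H(1), of v] insert.prems by (simp add: vertex_degree_def)
  finally have "card (col ` \<Union>?F) \<le> max_degree V E * r"
    using card_image_le[of "\<Union>?F" col] finF fine by fastforce
  then have "card (col ` \<Union>?F) < card {..max_degree V E * r}" by simp
  then have "\<not> {..max_degree V E * r} \<subseteq> col ` \<Union>?F"
    using card_mono[of "col ` \<Union>?F" "{..max_degree V E * r}"] finF fine by fastforce
  then obtain x where x: "x \<le> max_degree V E * r" "x \<notin> col ` \<Union>?F" by auto
  have "inj_on (col(v := x)) (e \<inter> insert v S)" if "e \<in> E" for e
  proof (cases "v \<in> e")
    case True
    then have "col w \<noteq> x" if "w \<in> e" for w using x that \<open>e \<in> E\<close> by blast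
    then show ?thesis using col(2)[OF that] insert.hyps
      by (auto simp: inj_on_def)
  next
    case False
    then show ?thesis using col(2)[OF that] by (auto simp: inj_on_def)
  qed
  moreover have "(col(v := x)) ` insert v S \<subseteq> {..max_degree V E * r}"
    using col(1) x(1) by auto
  ultimately show ?case by blast
qed

lemma chi_cf_bound:
  assumes H: "hypergraph V E" "uniform_edges r E"
  shows "chi_cf V E \<le> max_degree V E * r + 1"
proof -
  have "finite V" using H by (simp add: hypergraph_def)
  then obtain col where col: "col ` V \<subseteq> {..max_degree V E * r}"
    "\<And>e. e \<in> E \<Longrightarrow> inj_on col (e \<inter> V)"
    using ex_rainbow_coloring[OF H, of V] by auto
  have "conflict_free E col"
    unfolding conflict_free_def
  proof
    fix e assume e: "e \<in> E"
    then have "e \<inter> V = e" "e \<noteq> {}" using H(1) by (auto simp: hypergraph_def)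
    then show "\<exists>v\<in>e. \<forall>w\<in>e. w \<noteq> v \<longrightarrow> col w \<noteq> col v"
      using col(2)[OF e] unfolding inj_on_def by (metis ex_in_conv)
  qed
  then have "chi_cf V E \<le> card (col ` V)" by (rule chi_cf_le)
  also have "\<dots> \<le> card {..max_degree V E * r}" using col(1) by (intro card_mono) auto
  finally show ?thesis by simp
qed

lemma finite_cf_values: "finite (cf_values r \<Delta>)"
proof (rule finite_subset)
  show "cf_values r \<Delta> \<subseteq> {..\<Delta> * r + 1}"
    unfolding cf_values_def using chi_cf_bound by fastforce
qed simp

lemma cf_values_nonempty:
  assumes "r \<ge> 2"
  shows "cf_values r \<Delta> \<noteq> {}"
proof -
  define g where "g i = insert 0 {i * r + 1..<i * r + r}" for i :: nat
  define E where "E = g ` {..<\<Delta>}"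
  define V where "V = insert 0 (\<Union>E)"
  have mem: "i * r + 1 \<in> g j \<Longrightarrow> i = j" for i j
  proof -
    assume "i * r + 1 \<in> g j"
    then have "j * r + 1 \<le> i * r + 1" "i * r + 1 < j * r + r" by (auto simp: g_def)
    then have "j * r \<le> i * r" "i * r < Suc j * r" by auto
    then show "i = j" using assms by (metis le_antisym less_Suc_eq_le mult_less_cancel2 mult_le_cancel2 less_le_trans zero_less_numeral)
  qed
  have "i * r + 1 \<in> g i" for i using assms by (auto simp: g_def)
  then have inj: "inj_on g {..<\<Delta>}" using mem by (metis inj_onI)
  have H: "hypergraph V E" by (auto simp: hypergraph_def V_def E_def g_def)
  have U: "uniform_edges r E" using assms by (auto simp: uniform_edges_def E_def g_def)
  have cE: "card E = \<Delta>" using inj by (simp add: E_def card_image)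
  have "vertex_degree E v \<le> \<Delta>" for v
    unfolding vertex_degree_def cE[symmetric] using finite_edges[OF H] by (intro card_mono) auto
  moreover have "{e\<in>E. 0 \<in> e} = E" by (auto simp: E_def g_def)
  then have "vertex_degree E 0 = \<Delta>" by (simp add: vertex_degree_def cE)
  moreover have "finite V" "0 \<in> V" using H by (auto simp: hypergraph_def V_def)
  ultimately have "max_degree V E = \<Delta>"
    unfolding max_degree_def by (intro Max_eqI) (auto simp: image_iff intro!: bexI[of _ 0])
  then show ?thesis using H U unfolding cf_values_def by blast
qed

lemma chi_cf_in_cf_values:
  fixes V :: "'a set"
  assumes H: "hypergraph V E" "uniform_edges r E"
  shows "chi_cf V E \<in> cf_values r (max_degree V E)"
proof -
  have finV: "finite V" and sub: "\<And>e. e \<in> E \<Longrightarrow> e \<subseteq> V" "\<And>e. e \<in> E \<Longrightarrow> e \<noteq> {}"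
    using H(1) by (auto simp: hypergraph_def)
  obtain h :: "'a \<Rightarrow> nat" where inj: "inj_on h V"
    using finite_imp_inj_to_nat_seg[OF finV] by blast
  define W where "W = h ` V"
  define F where "F = (`) h ` E"
  define k where "k = inv_into V h"
  have kh: "k (h v) = v" if "v \<in> V" for v using that inj by (simp add: k_def)
  have HW: "hypergraph W F" using H(1) by (auto simp: hypergraph_def W_def F_def)
  have UW: "uniform_edges r F"
    using H(2) sub inj by (auto simp: uniform_edges_def F_def card_image inj_on_subset)
  have injE: "inj_on ((`) h) E"
    using inj_on_image_Pow[OF inj] sub(1) by (auto intro: inj_on_subset)
  have deg: "vertex_degree F (h v) = vertex_degree E v" if "v \<in> V" for v
  proof -
    have "{e\<in>F. h v \<in> e} = (`) h ` {e\<in>E. v \<in> e}"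
    proof -
      have "h v \<in> h ` e \<longleftrightarrow> v \<in> e" if "e \<in> E" for e
        using inj_on_image_mem_iff[OF inj \<open>v \<in> V\<close> sub(1)[OF that]] .
      then show ?thesis unfolding F_def by blast
    qed
    then show ?thesis
      unfolding vertex_degree_def using card_image[of "(`) h" "{e\<in>E. v \<in> e}"] injE
      by (auto intro: inj_on_subset)
  qed
  then have D: "max_degree W F = max_degree V E"
    by (simp add: max_degree_def W_def image_image)
  have to: "conflict_free F (col \<circ> k)" "card ((col \<circ> k) ` W) = card (col ` V)"
    if cf: "conflict_free E col" for col
  proof -
    have *: "k (h v) = v" if "v \<in> e" "e \<in> E" for v e using that sub(1) kh by blast
    show "conflict_free F (col \<circ> k)"
      unfolding conflict_free_def F_def
    proof (safe, goal_cases)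
      case (1 _ e)
      then obtain v where v: "v \<in> e" "\<forall>w\<in>e. w \<noteq> v \<longrightarrow> col w \<noteq> col v"
        using cf by (auto simp: conflict_free_def)
      then show ?case using * 1 by (intro bexI[of _ "h v"]) auto
    qed
    show "card ((col \<circ> k) ` W) = card (col ` V)"
      by (simp add: W_def image_image kh)
  qed
  have from_F: "conflict_free E (col \<circ> h)" "card ((col \<circ> h) ` V) = card (col ` W)"
    if cf: "conflict_free F col" for col
  proof -
    show "conflict_free E (col \<circ> h)"
      unfolding conflict_free_def
    proof
      fix e assume e: "e \<in> E"
      then obtain v where v: "v \<in> e" "\<forall>w\<in>e. h w \<noteq> h v \<longrightarrow> col (h w) \<noteq> col (h v)"
        using cf by (auto simp: conflict_free_def F_def)
      have "h w \<noteq> h v" if "w \<in> e" "w \<noteq> v" for w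
        using inj sub(1)[OF e] v(1) that by (meson inj_on_def subsetD)
      then show "\<exists>v\<in>e. \<forall>w\<in>e. w \<noteq> v \<longrightarrow> (col \<circ> h) w \<noteq> (col \<circ> h) v"
        using v by auto
    qed
    show "card ((col \<circ> h) ` V) = card (col ` W)" by (simp add: W_def image_image)
  qed
  have "(\<exists>col. conflict_free E col \<and> card (col ` V) = n) \<longleftrightarrow>
        (\<exists>col. conflict_free F col \<and> card (col ` W) = n)" for n
    using to from_F by metis
  then have "chi_cf V E = chi_cf W F" by (simp add: chi_cf_def)
  then show ?thesis using HW UW D unfolding cf_values_def by auto
qed

end

theory Submission
  imports Defs "HOL-Library.FuncSet" "HOL-Real_Asymp.Real_Asymp"
begin

text \<open>
  The three parts rest on three different ideas.

  \<^bold>\<open>The value \<open>\<Delta> + 1\<close>.\<close> Every hypergraph of maximum degree \<open>\<Delta>\<close> has a conflict-free colouring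
  with \<open>\<Delta> + 1\<close> colours (\<open>chi_cf_le_max_degree\<close>). Give colour 0 to all vertices outside an
  inclusion-minimal transversal \<open>T\<close>, and colour \<open>T\<close> greedily so that each edge keeps a
  vertex of \<open>T\<close> with a unique colour. By minimality each \<open>v \<in> T\<close> has a private edge meeting \<open>T\<close> only in
  \<open>v\<close>, which is never an obstacle, so at most \<open>\<Delta> - 1\<close> colours are forbidden when \<open>v\<close> is coloured.
  For \<open>r = 2\<close> complete graphs attain the bound. For \<open>\<Delta> = 2\<close> and two colours, say red and blue, an
  edge of size \<open>r\<close> is good iff it has exactly 1 or \<open>r - 1\<close> red vertices. For even \<open>r\<close> this is violated by three
  blocks of size \<open>r / 2\<close> whose pairwise unions are the edges: the three red counts would be odd with
  even sum. For odd \<open>r \<ge> 7\<close> three similar edges force a set of three further vertices to contain both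
  colours, and an edge through two such triples has at least two vertices of either colour.

  \<^bold>\<open>Logarithmic degree.\<close> Colour at random with few ``real'' colours, and for \<open>\<Delta> \<le> r\<close> give all
  remaining vertices one common ``blank'' colour. By a union-bound-like recursion
  on the \<^emph>\<open>number\<close> of good partial colourings (\<open>avoiding_colorings_growth\<close>, a counting substitute for
  the Lovasz local lemma) it suffices that an edge is bad with probability at most
  \<open>1 / (e r \<Delta>)\<close>. Edges without a unique real colour are counted by the exponential
  generating function \<open>exp (z x) (exp x - x) ^ k\<close> (\<open>card_singleton_free_le\<close>), and a suitable choice of \<open>x\<close>
  bounds the probability, up to powers of \<open>r\<close>, by \<open>exp (- \<Omega>(\<Delta>))\<close> if \<open>\<Delta> \<le> r\<close> and by
  \<open>exp (- \<Omega>(r)) (r / \<Delta>) ^ (r / 2)\<close> otherwise.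

  \<^bold>\<open>Four-uniform hypergraphs.\<close> This is an analogue of Brooks' theorem. In a 4-set, the colours of three
  vertices spoil at most one colour of the fourth. Hence, in a \<open>\<Delta>\<close>-colouring with the fewest bad
  edges, a vertex \<open>v\<close> of a bad edge is tight: its edges correspond bijectively to the colours they
  spoil at \<open>v\<close>. Recolouring \<open>v\<close> therefore moves the defect to any other edge at \<open>v\<close>, and
  defects can be walked through the hypergraph. If a defect leaves an edge with two colour classes through \<open>v\<close> by a colour not
  on the edge and comes back through a vertex outside the colour class of \<open>v\<close>, it finds the
  other three vertices with three different colours, which spoil nothing: a contradiction to tightness.
  An edge around which such walks exist is found in a minimal piece of the incidence graph that is attached
  to the rest by at most one node (\<open>locally_2_connected_piece\<close>).
\<close>

section \<open>Bounding the conflict-free chromatic number\<close>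

lemma chi_cf_le_of_palette:
  assumes "conflict_free E col" "\<And>v. v \<in> V \<Longrightarrow> col v < n"
  shows "chi_cf V E \<le> n"
proof -
  have "card (col ` V) \<le> card {..<n}" using assms(2) by (intro card_mono) auto
  then show ?thesis using chi_cf_le[OF assms(1), of V] by simp
qed

lemma f_cf_le:
  assumes "r \<ge> 2"
    and "\<And>(V :: nat set) E. hypergraph V E \<Longrightarrow> uniform_edges r E \<Longrightarrow> max_degree V E = \<Delta> \<Longrightarrow> chi_cf V E \<le> n"
  shows "f_cf r \<Delta> \<le> n"
proof -
  have "\<forall>k\<in>cf_values r \<Delta>. k \<le> n" using assms(2) by (auto simp: cf_values_def)
  then show ?thesis
    unfolding f_cf_def using finite_cf_values cf_values_nonempty[OF assms(1)] by (simp add: Max_le_iff)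
qed

lemma vertex_degree_le_max_degree:
  assumes "hypergraph V E"
  shows "vertex_degree E v \<le> max_degree V E"
proof (cases "v \<in> V")
  case False
  then have none: "{e\<in>E. v \<in> e} = {}" using assms by (auto simp: hypergraph_def)
  then show ?thesis unfolding vertex_degree_def none by simp
qed (rule degree_le_max_degree[OF assms])

section \<open>Maximum degree plus one colours suffice\<close>

lemma ex_minimal_transversal:
  assumes "hypergraph V E"
  shows "\<exists>T \<subseteq> V. (\<forall>e\<in>E. e \<inter> T \<noteq> {}) \<and> (\<forall>v\<in>T. \<exists>e\<in>E. e \<inter> T = {v})"
proof -
  let ?hits = "\<lambda>T. T \<subseteq> V \<and> (\<forall>e\<in>E. e \<inter> T \<noteq> {})"
  have "?hits V" using assms by (auto simp: hypergraph_def Int_absorb2)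
  from ex_has_least_nat[of ?hits, OF this, of card]
  obtain T where T: "?hits T \<and> (\<forall>T'. ?hits T' \<longrightarrow> card T \<le> card T')" ..
  note min = T[THEN conjunct2, rule_format] and T = T[THEN conjunct1]
  have "finite T" using T assms by (auto simp: hypergraph_def intro: finite_subset)
  have "\<exists>e\<in>E. e \<inter> T = {v}" if v: "v \<in> T" for v
  proof (rule ccontr)
    assume no: "\<not> ?thesis"
    have "e \<inter> (T - {v}) \<noteq> {}" if "e \<in> E" for e
    proof -
      have "e \<inter> T \<noteq> {}" "e \<inter> T \<noteq> {v}" using T no that by simp_all
      then show ?thesis by blast
    qed
    then have "?hits (T - {v})" using T by blast
    from min[OF this] have "card T \<le> card (T - {v})" .
    then show False using \<open>finite T\<close> v by (metis card_Diff1_less not_less)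
  qed
  then show ?thesis using T by blast
qed

text \<open>The set \<open>A\<close> grows from \<open>{}\<close> to \<open>T\<close>. When \<open>v\<close> is added, an edge through \<open>v\<close> that already meets \<open>A\<close>
  must keep its unique colour, which forbids that one colour for \<open>v\<close>; an edge that does not meet \<open>A\<close> gets \<open>v\<close> as
  its witness. The private edge of \<open>v\<close> is of the second kind, so fewer than \<open>n\<close> colours are
  forbidden.\<close>
lemma ex_transversal_coloring:
  assumes "finite E" "\<And>v. vertex_degree E v \<le> n"
    and "\<And>v. v \<in> T \<Longrightarrow> \<exists>e\<in>E. e \<inter> T = {v}"
    and "finite A" "A \<subseteq> T"
  shows "\<exists>col. (\<forall>v\<in>A. 1 \<le> col v \<and> col v \<le> n) \<and>
    (\<forall>e\<in>E. e \<inter> A \<noteq> {} \<longrightarrow> conflict_free {e \<inter> A} col)"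
  using assms(4,5)
proof (induction A rule: finite_induct)
  case empty
  then show ?case by simp
next
  case (insert v A)
  then have "A \<subseteq> T" by simp
  from insert.IH[OF this] obtain col where col: "\<forall>u\<in>A. 1 \<le> col u \<and> col u \<le> n"
    "\<forall>e\<in>E. e \<inter> A \<noteq> {} \<longrightarrow> conflict_free {e \<inter> A} col" by blast
  note col = col[rule_format]
  define F where "F = {e\<in>E. v \<in> e \<and> e \<inter> A \<noteq> {}}"
  have "\<exists>u\<in>e \<inter> A. \<forall>w\<in>e \<inter> A. w \<noteq> u \<longrightarrow> col w \<noteq> col u" if "e \<in> F" for e
    using col(2)[of e] that by (simp add: F_def conflict_free_def)
  then obtain rep where rep: "\<And>e. e \<in> F \<Longrightarrow> rep e \<in> e \<inter> A"
    "\<And>e w. e \<in> F \<Longrightarrow> w \<in> e \<inter> A \<Longrightarrow> w \<noteq> rep e \<Longrightarrow> col w \<noteq> col (rep e)"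
    by metis
  obtain p where p: "p \<in> E" "p \<inter> T = {v}" using assms(3)[of v] insert.prems by auto
  have finF: "finite F" using assms(1) by (simp add: F_def)
  have "p \<notin> F" "F \<subseteq> {e\<in>E. v \<in> e}" using p insert.prems insert.hyps(2) by (auto simp: F_def)
  then have "F \<subset> {e\<in>E. v \<in> e}" using p by blast
  then have "card F < vertex_degree E v"
    unfolding vertex_degree_def using assms(1) by (intro psubset_card_mono) auto
  then have "card F < n" using assms(2) by (meson le_trans not_le)
  moreover have "card ((col \<circ> rep) ` F) \<le> card F" by (rule card_image_le[OF finF])
  ultimately have "card ((col \<circ> rep) ` F) < card {1..n}" by simp
  then have "\<not> {1..n} \<subseteq> (col \<circ> rep) ` F"
    using card_mono[OF finite_imageI[OF finF], of "{1..n}" "col \<circ> rep"] by linarith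
  then obtain c where c: "1 \<le> c" "c \<le> n" "c \<notin> (col \<circ> rep) ` F"
    by (metis atLeastAtMost_iff subsetI)
  have "conflict_free {e \<inter> insert v A} (col(v := c))" if e: "e \<in> E" "e \<inter> insert v A \<noteq> {}" for e
  proof -
    consider "v \<notin> e" | "v \<in> e" "e \<inter> A = {}" | "e \<in> F" using e by (auto simp: F_def)
    then show ?thesis
    proof cases
      case 1
      then have "e \<inter> insert v A = e \<inter> A" "conflict_free {e \<inter> A} col" using e col(2) by auto
      moreover have "\<And>w. w \<in> e \<inter> A \<Longrightarrow> (col(v := c)) w = col w" using 1 by auto
      ultimately show ?thesis unfolding conflict_free_def by (metis singletonD insertI1)
    next
      case 2
      then have "e \<inter> insert v A = {v}" by auto
      then show ?thesis by (simp add: conflict_free_def)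
    next
      case 3
      then have "rep e \<in> e \<inter> insert v A" "rep e \<noteq> v" using rep(1) insert.hyps(2) by auto
      moreover have "(col(v := c)) w \<noteq> (col(v := c)) (rep e)" if "w \<in> e \<inter> insert v A" "w \<noteq> rep e" for w
        using that rep(2)[OF 3] c(3) 3 \<open>rep e \<noteq> v\<close> by auto
      ultimately show ?thesis unfolding conflict_free_def by blast
    qed
  qed
  moreover have "\<forall>u\<in>insert v A. 1 \<le> (col(v := c)) u \<and> (col(v := c)) u \<le> n" using col(1) c by simp
  ultimately show ?case by blast
qed

theorem chi_cf_le_max_degree:
  assumes "hypergraph V E"
  shows "chi_cf V E \<le> max_degree V E + 1"
proof -
  from ex_minimal_transversal[OF assms] obtain T where
    T: "T \<subseteq> V" "\<forall>e\<in>E. e \<inter> T \<noteq> {}" "\<forall>v\<in>T. \<exists>e\<in>E. e \<inter> T = {v}" by (elim exE conjE)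
  note T = T(1) T(2,3)[rule_format]
  have "finite T" using T(1) assms by (auto simp: hypergraph_def intro: finite_subset)
  from ex_transversal_coloring[OF finite_edges[OF assms] vertex_degree_le_max_degree[OF assms] T(3) this subset_refl]
  obtain col where col: "\<forall>v\<in>T. 1 \<le> col v \<and> col v \<le> max_degree V E"
      "\<forall>e\<in>E. e \<inter> T \<noteq> {} \<longrightarrow> conflict_free {e \<inter> T} col" by blast
  note col = col[rule_format]
  \<comment> \<open>Colours on \<open>T\<close> start at 1, so colour 0 outside \<open>T\<close> cannot destroy a unique colour.\<close>
  define col' where "col' v = (if v \<in> T then col v else 0)" for v
  have "conflict_free E col'"
    unfolding conflict_free_def
  proof
    fix e assume e: "e \<in> E"
    then obtain v where v: "v \<in> e \<inter> T" "\<And>w. w \<in> e \<inter> T \<Longrightarrow> w \<noteq> v \<Longrightarrow> col w \<noteq> col v"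
      using col(2)[OF e T(2)[OF e]] by (auto simp: conflict_free_def)
    have "col' w \<noteq> col' v" if "w \<in> e" "w \<noteq> v" for w
      using v(2)[of w] v(1) that col(1)[of v] by (auto simp: col'_def)
    then show "\<exists>v\<in>e. \<forall>w\<in>e. w \<noteq> v \<longrightarrow> col' w \<noteq> col' v" using v(1) by blast
  qed
  moreover have "col' v < max_degree V E + 1" for v using col(1)[of v] by (auto simp: col'_def)
  ultimately show ?thesis by (rule chi_cf_le_of_palette)
qed

section \<open>Hypergraphs that need one colour more than the maximum degree\<close>

text \<open>Bounding all conflict-free colourings bounds the minimum only because at least one exists; an
  injective colouring serves.\<close>
lemma le_chi_cf:
  assumes "hypergraph V E"
    and "\<And>col. conflict_free E col \<Longrightarrow> n \<le> card (col ` V)"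
  shows "n \<le> chi_cf V E"
proof -
  obtain h :: "'a \<Rightarrow> nat" where inj: "inj_on h V"
    using finite_imp_inj_to_nat_seg[of V] assms(1) by (auto simp: hypergraph_def)
  have "conflict_free E h"
    unfolding conflict_free_def
  proof
    fix e assume "e \<in> E"
    then have "e \<noteq> {}" "e \<subseteq> V" using assms(1) by (auto simp: hypergraph_def)
    then show "\<exists>v\<in>e. \<forall>w\<in>e. w \<noteq> v \<longrightarrow> h w \<noteq> h v" using inj unfolding inj_on_def by blast
  qed
  then have "\<exists>k. \<exists>col. conflict_free E col \<and> card (col ` V) = k" by blast
  then have "\<exists>col. conflict_free E col \<and> card (col ` V) = chi_cf V E"
    unfolding chi_cf_def by (rule LeastI_ex)
  then show ?thesis using assms(2) by metis
qed

lemma le_f_cf: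
  assumes "hypergraph V E" "uniform_edges r E" "max_degree V E = \<Delta>"
    and "\<And>col. conflict_free E col \<Longrightarrow> n \<le> card (col ` V)"
  shows "n \<le> f_cf r \<Delta>"
proof -
  have "chi_cf V E \<in> cf_values r \<Delta>" using chi_cf_in_cf_values[OF assms(1,2)] assms(3) by simp
  then have "chi_cf V E \<le> f_cf r \<Delta>" unfolding f_cf_def by (intro Max_ge finite_cf_values)
  then show ?thesis using le_chi_cf[OF assms(1,4)] by simp
qed

lemma complete_graph_lower_bound: "\<Delta> + 1 \<le> f_cf 2 \<Delta>"
proof (cases "\<Delta> = 0")
  case True
  have H: "hypergraph {0 :: nat} {}" "uniform_edges 2 ({} :: nat set set)" "max_degree {0 :: nat} {} = 0"
    by (auto simp: hypergraph_def uniform_edges_def max_degree_def vertex_degree_def)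
  show ?thesis using le_f_cf[OF H, of 1] True by simp
next
  case False
  define V where "V = {..\<Delta>}"
  define E where "E = {e. e \<subseteq> V \<and> card e = 2}"
  have H: "hypergraph V E" "uniform_edges 2 E"
    by (auto simp: hypergraph_def uniform_edges_def E_def V_def)
  have deg: "vertex_degree E v = \<Delta>" if v: "v \<in> V" for v
  proof -
    have "{e\<in>E. v \<in> e} = (\<lambda>w. {v, w}) ` (V - {v})"
      using v by (auto simp: E_def card_2_iff)
    moreover have "inj_on (\<lambda>w. {v, w}) (V - {v})" by (auto simp: inj_on_def doubleton_eq_iff)
    ultimately show ?thesis using v by (simp add: vertex_degree_def card_image V_def)
  qed
  then have "vertex_degree E ` V = {\<Delta>}" by (auto simp: V_def)
  then have M: "max_degree V E = \<Delta>" by (simp add: max_degree_def)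
  have "\<Delta> + 1 \<le> card (col ` V)" if cf: "conflict_free E col" for col :: "nat \<Rightarrow> nat"
  proof -
    have "inj_on col V"
    proof (rule inj_onI, rule ccontr)
      fix v w assume "v \<in> V" "w \<in> V" "col v = col w" "v \<noteq> w"
      moreover from this have "{v, w} \<in> E" by (simp add: E_def)
      ultimately show False using cf unfolding conflict_free_def by fastforce
    qed
    then show ?thesis by (simp add: card_image V_def)
  qed
  then show ?thesis by (rule le_f_cf[OF H M])
qed

text \<open>Blow-up of an index set \<open>I\<close>: index \<open>i\<close> is replaced by a block of \<open>s i\<close> vertices. Blowing up a small
  hypergraph on indices keeps its degrees, while the conflict-free condition on an edge only depends on how many
  vertices of each block have a given colour.\<close>
definition block_union :: "(nat \<Rightarrow> nat) \<Rightarrow> nat set \<Rightarrow> (nat \<times> nat) set" where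
  "block_union s I = (SIGMA i:I. {..<s i})"

lemma card_block_union: "finite I \<Longrightarrow> card (block_union s I) = (\<Sum>i\<in>I. s i)"
  by (simp add: block_union_def)

lemma card_colour_class_block_union:
  assumes "finite I"
  shows "card {v \<in> block_union s I. col v = a} = (\<Sum>i\<in>I. card {j. j < s i \<and> col (i, j) = a})"
proof -
  have "{v \<in> block_union s I. col v = a} = (SIGMA i:I. {j. j < s i \<and> col (i, j) = a})"
    by (auto simp: block_union_def)
  then show ?thesis using assms by simp
qed

lemma unique_colour_count:
  assumes "conflict_free {e} col" "card e = r" "r \<ge> 2" "col ` e \<subseteq> {a, b}"
  shows "card {v\<in>e. col v = a} = 1 \<or> card {v\<in>e. col v = a} = r - 1"
proof -
  obtain v where v: "v \<in> e" "\<And>w. w \<in> e \<Longrightarrow> w \<noteq> v \<Longrightarrow> col w \<noteq> col v"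
    using assms(1) by (auto simp: conflict_free_def)
  show ?thesis
  proof (cases "col v = a")
    case True
    then have "{w\<in>e. col w = a} = {v}" using v by auto
    then show ?thesis by simp
  next
    case False
    then have "{w\<in>e. col w = a} = e - {v}" using v assms(4) by blast
    then show ?thesis using v(1) assms(2,3) by (simp add: card_Diff_singleton)
  qed
qed

text \<open>A 2-colouring of the blow-up is reduced to the number \<open>\<rho> i\<close> of vertices of
  colour \<open>a\<close> in block \<open>i\<close>, which turns the lower bound into an arithmetic question about the index
  hypergraph.\<close>
lemma degree_two_lower_bound:
  fixes \<I> :: "nat set set" and s :: "nat \<Rightarrow> nat"
  assumes "finite \<I>" and I: "\<And>I. I \<in> \<I> \<Longrightarrow> finite I \<and> I \<noteq> {} \<and> (\<Sum>i\<in>I. s i) = r"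
    and s: "\<And>i. i \<in> \<Union>\<I> \<Longrightarrow> 0 < s i"
    and deg: "\<And>i. i \<in> \<Union>\<I> \<Longrightarrow> vertex_degree \<I> i \<le> 2" and "\<exists>i\<in>\<Union>\<I>. vertex_degree \<I> i = 2"
    and "r \<ge> 2"
    and no: "\<And>\<rho>. (\<And>i. \<rho> i \<le> s i) \<Longrightarrow> (\<And>I. I \<in> \<I> \<Longrightarrow> (\<Sum>i\<in>I. \<rho> i) = 1 \<or> (\<Sum>i\<in>I. \<rho> i) = r - 1) \<Longrightarrow> False"
  shows "3 \<le> f_cf r 2"
proof -
  define E where "E = block_union s ` \<I>"
  define V where "V = block_union s (\<Union>\<I>)"
  have ne: "\<I> \<noteq> {}" using assms(5) by blast
  have inj: "inj_on (block_union s) \<I>"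
  proof (rule inj_onI)
    fix I J assume IJ: "I \<in> \<I>" "J \<in> \<I>" "block_union s I = block_union s J"
    have "i \<in> I \<longleftrightarrow> (i, 0) \<in> block_union s I" "i \<in> J \<longleftrightarrow> (i, 0) \<in> block_union s J" for i
      using s[of i] IJ(1,2) by (auto simp: block_union_def)
    then show "I = J" using IJ(3) by auto
  qed
  have "(i, 0) \<in> V" if "i \<in> \<Union>\<I>" for i using s[OF that] that by (simp add: V_def block_union_def)
  then have nonempty: "V \<noteq> {}" using assms(5) by blast
  have finV: "finite V" using assms(1) I unfolding V_def block_union_def
    by (intro finite_SigmaI finite_Union) auto
  have edge: "block_union s I \<subseteq> V \<and> block_union s I \<noteq> {}" if "I \<in> \<I>" for I
    using that I[OF that] s by (fastforce simp: V_def block_union_def)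
  have H: "hypergraph V E" using finV nonempty edge by (auto simp: hypergraph_def E_def)
  have U: "uniform_edges r E" using I by (auto simp: uniform_edges_def E_def card_block_union)
  have degE: "vertex_degree E (i, j) = vertex_degree \<I> i" if "(i, j) \<in> V" for i j
  proof -
    have "{e\<in>E. (i, j) \<in> e} = block_union s ` {I\<in>\<I>. i \<in> I}"
      using that by (auto simp: E_def V_def block_union_def)
    then show ?thesis
      unfolding vertex_degree_def using inj by (simp add: card_image inj_on_subset)
  qed
  have M: "max_degree V E = 2"
    unfolding max_degree_def
  proof (rule Max_eqI)
    show "finite (vertex_degree E ` V)" using finV by simp
    show "y \<le> 2" if "y \<in> vertex_degree E ` V" for y
    proof -
      obtain i j where ij: "(i, j) \<in> V" "y = vertex_degree E (i, j)" using \<open>y \<in> _\<close> by auto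
      then have "i \<in> \<Union>\<I>" by (auto simp: V_def block_union_def)
      then show ?thesis using degE ij deg by simp
    qed
    obtain i where i: "i \<in> \<Union>\<I>" "vertex_degree \<I> i = 2" using assms(5) by blast
    then have "(i, 0) \<in> V" using s by (simp add: V_def block_union_def)
    then show "2 \<in> vertex_degree E ` V" using degE i(2) by (metis image_eqI)
  qed
  have "3 \<le> card (col ` V)" if cf: "conflict_free E col" for col :: "nat \<times> nat \<Rightarrow> nat"
  proof (rule ccontr)
    assume "\<not> ?thesis"
    then have "card (col ` V) \<le> 2" by simp
    moreover have "card (col ` V) \<noteq> 0" using finV nonempty by simp
    ultimately have "card (col ` V) = 1 \<or> card (col ` V) = 2" by linarith
    then have "\<exists>a b. col ` V = {a, b}" by (metis card_1_singletonE card_2_iff insert_absorb2)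
    then obtain a b where ab: "col ` V \<subseteq> {a, b}" by blast
    define \<rho> where "\<rho> i = card {j. j < s i \<and> col (i, j) = a}" for i
    show False
    proof (rule no[of \<rho>])
      have "card {j. j < s i \<and> col (i, j) = a} \<le> card {..<s i}" for i by (intro card_mono) auto
      then show "\<rho> i \<le> s i" for i by (simp add: \<rho>_def)
      fix I assume I': "I \<in> \<I>"
      have "conflict_free {block_union s I} col" using cf I' by (simp add: conflict_free_def E_def)
      moreover have "col ` block_union s I \<subseteq> {a, b}" using ab edge[OF I'] by blast
      ultimately show "(\<Sum>i\<in>I. \<rho> i) = 1 \<or> (\<Sum>i\<in>I. \<rho> i) = r - 1"
        using unique_colour_count[of "block_union s I" col r a b] card_block_union[of I s] I[OF I'] \<open>r \<ge> 2\<close>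
        by (simp add: \<rho>_def card_colour_class_block_union)
    qed
  qed
  then show ?thesis by (rule le_f_cf[OF H U M])
qed

lemma vertex_degree_insert:
  assumes "finite E" "e \<notin> E"
  shows "vertex_degree (insert e E) v = (if v \<in> e then 1 else 0) + vertex_degree E v"
proof -
  have "{f\<in>insert e E. v \<in> f} = (if v \<in> e then insert e {f\<in>E. v \<in> f} else {f\<in>E. v \<in> f})" by auto
  then show ?thesis using assms by (simp add: vertex_degree_def)
qed

lemma vertex_degree_empty: "vertex_degree {} v = 0"
  by (simp add: vertex_degree_def)

lemma degree_two_lower_bound_even:
  assumes "even r" "r \<ge> 4"
  shows "3 \<le> f_cf r 2"
proof -
  obtain m where r: "r = 2 * m" using assms(1) by blast
  have m: "m \<ge> 2" using assms(2) r by simp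
  let ?I = "{{0, 1}, {0, 2}, {1, 2}} :: nat set set"
  have un: "\<Union>?I = {0, 1, 2}" by auto
  have deg: "vertex_degree ?I i = 2" if "i \<in> {0, 1, 2}" for i
    using that by (auto simp: vertex_degree_insert vertex_degree_empty set_eq_subset)
  show ?thesis
  proof (rule degree_two_lower_bound[of ?I "\<lambda>_. m"])
    fix \<rho> :: "nat \<Rightarrow> nat"
    assume le: "\<And>i. \<rho> i \<le> m" and s: "\<And>I. I \<in> ?I \<Longrightarrow> (\<Sum>i\<in>I. \<rho> i) = 1 \<or> (\<Sum>i\<in>I. \<rho> i) = r - 1"
    have odd: "odd k" if "k = 1 \<or> k = r - 1" for k using that assms by auto
    have "odd (\<rho> 0 + \<rho> 1)" by (rule odd) (use s[of "{0, 1}"] in simp)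
    moreover have "odd (\<rho> 0 + \<rho> 2)" by (rule odd) (use s[of "{0, 2}"] in simp)
    moreover have "odd (\<rho> 1 + \<rho> 2)" by (rule odd) (use s[of "{1, 2}"] in simp)
    ultimately show False by auto
  next
    show "vertex_degree ?I i \<le> 2" if "i \<in> \<Union>?I" for i using that unfolding un by (simp only: deg)
    show "\<exists>i\<in>\<Union>?I. vertex_degree ?I i = 2" unfolding un using deg[of 0] by (intro bexI[of _ 0]) simp_all
  qed (use m r in auto)
qed

text \<open>The gadget has the edges \<open>P \<union> Q\<close>, \<open>P \<union> S\<close> and \<open>Q \<union> S \<union> T\<close> on disjoint blocks
  of sizes \<open>m + 3\<close>, \<open>m\<close>, \<open>m\<close> and 3, so \<open>r = 2 m + 3\<close>. As \<open>m \<ge> 2\<close>, no block \<open>S\<close> or \<open>Q\<close> is large enough to let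
  the first two edges have different majority colours. So \<open>q = s\<close>, and a parity or size
  count rules out a monochromatic \<open>T\<close>.\<close>
lemma odd_gadget:
  fixes p q s t m :: nat
  assumes "m \<ge> 2" "p \<le> m + 3" "q \<le> m" "s \<le> m" "t \<le> 3"
    and "p + q = 1 \<or> p + q = 2 * m + 2" "p + s = 1 \<or> p + s = 2 * m + 2"
      "q + s + t = 1 \<or> q + s + t = 2 * m + 2"
  shows "1 \<le> t \<and> t \<le> 2"
proof (cases "p + q = 1")
  case True
  then have "p + s = 1" using assms by linarith
  moreover have "q = 0 \<or> q = 1" using True by linarith
  ultimately show ?thesis using True assms by linarith
next
  case False
  then have "p + q = 2 * m + 2" "p + s = 2 * m + 2" using assms by linarith+
  moreover from this have "q = m \<or> q + 1 = m" using assms by linarith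
  ultimately show ?thesis using assms by linarith
qed

text \<open>Two gadgets, on the blocks \<open>0, 1, 2, 3\<close> and \<open>4, 5, 6, 7\<close>, and one edge through their triples 3 and 7,
  filled up to size \<open>r\<close> by the block 8 of vertices of degree 1. Each triple has both colours, so that edge contains
  each colour at least twice. The filling has size \<open>r - 6\<close>, which is positive as \<open>r \<ge> 7\<close>.\<close>
lemma degree_two_lower_bound_odd:
  assumes "odd r" "r \<ge> 7"
  shows "3 \<le> f_cf r 2"
proof -
  obtain m where r: "r = 2 * m + 3" and m: "m \<ge> 2"
  proof -
    obtain k where "r = 2 * k + 1" using assms(1) oddE by blast
    then show thesis using that[of "k - 1"] assms(2) by simp
  qed
  let ?I = "{{0, 1}, {0, 2}, {1, 2, 3}, {4, 5}, {4, 6}, {5, 6, 7}, {3, 7, 8}} :: nat set set"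
  define s :: "nat \<Rightarrow> nat" where "s i = (if i \<in> {0, 4} then m + 3 else if i \<in> {3, 7} then 3
    else if i = 8 then 2 * m - 3 else m)" for i
  have un: "\<Union>?I = {0, 1, 2, 3, 4, 5, 6, 7, 8}" by auto
  have deg: "vertex_degree ?I i = (if i = 8 then 1 else 2)" if "i \<in> {0, 1, 2, 3, 4, 5, 6, 7, 8}" for i
    using that by (elim insertE) (simp_all add: vertex_degree_insert vertex_degree_empty set_eq_subset)
  show ?thesis
  proof (rule degree_two_lower_bound[of ?I s])
    fix \<rho> :: "nat \<Rightarrow> nat"
    assume le: "\<And>i. \<rho> i \<le> s i" and sm: "\<And>I. I \<in> ?I \<Longrightarrow> (\<Sum>i\<in>I. \<rho> i) = 1 \<or> (\<Sum>i\<in>I. \<rho> i) = r - 1"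
    have "1 \<le> \<rho> 3 \<and> \<rho> 3 \<le> 2"
      using sm[of "{0, 1}"] sm[of "{0, 2}"] sm[of "{1, 2, 3}"] le[of 0] le[of 1] le[of 2] le[of 3] m r
      by (intro odd_gadget[of m "\<rho> 0" "\<rho> 1" "\<rho> 2"]) (simp_all add: s_def add.assoc)
    moreover have "1 \<le> \<rho> 7 \<and> \<rho> 7 \<le> 2"
      using sm[of "{4, 5}"] sm[of "{4, 6}"] sm[of "{5, 6, 7}"] le[of 4] le[of 5] le[of 6] le[of 7] m r
      by (intro odd_gadget[of m "\<rho> 4" "\<rho> 5" "\<rho> 6"]) (simp_all add: s_def add.assoc)
    moreover have "\<rho> 3 + \<rho> 7 + \<rho> 8 = 1 \<or> \<rho> 3 + \<rho> 7 + \<rho> 8 = 2 * m + 2"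
      using sm[of "{3, 7, 8}"] r by (simp add: add.assoc)
    moreover have "\<rho> 8 \<le> 2 * m - 3" using le[of 8] by (simp add: s_def)
    ultimately show False using m by linarith
  next
    show "finite I \<and> I \<noteq> {} \<and> (\<Sum>i\<in>I. s i) = r" if "I \<in> ?I" for I
      using that m r by (elim insertE) (simp_all add: s_def)
  next
    show "0 < s i" if "i \<in> \<Union>?I" for i using m by (simp add: s_def)
  next
    show "vertex_degree ?I i \<le> 2" if "i \<in> \<Union>?I" for i using that unfolding un by (simp only: deg) simp
    show "\<exists>i\<in>\<Union>?I. vertex_degree ?I i = 2" unfolding un using deg[of 0] by (intro bexI[of _ 0]) simp_all
  qed (use r in auto)
qed

theorem f_cf_eq:
  assumes "r \<ge> 2" "\<Delta> \<ge> 1" "r = 2 \<or> (\<Delta> = 2 \<and> r \<notin> {3, 5})"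
  shows "f_cf r \<Delta> = \<Delta> + 1"
proof (rule antisym)
  show "f_cf r \<Delta> \<le> \<Delta> + 1"
    using assms(1) chi_cf_le_max_degree by (intro f_cf_le) blast+
  consider "r = 2" | "\<Delta> = 2" "even r" "r \<ge> 4" | "\<Delta> = 2" "odd r" "r \<ge> 7"
  proof -
    have "r = 2 \<or> even r \<and> r \<ge> 4 \<or> odd r \<and> r \<ge> 7" if "r \<notin> {3, 5}"
      using that assms(1) by simp presburger
    then show thesis using assms(3) that by blast
  qed
  then show "\<Delta> + 1 \<le> f_cf r \<Delta>"
  proof cases
    case 1
    then show ?thesis using complete_graph_lower_bound by simp
  next
    case 2
    then show ?thesis using degree_two_lower_bound_even by simp
  next
    case 3
    then show ?thesis using degree_two_lower_bound_odd by simp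
  qed
qed

section \<open>Counting colourings that avoid local patterns\<close>

lemma restrict_restrict_subset: "A \<subseteq> B \<Longrightarrow> restrict (restrict c B) A = restrict c A"
  by (simp add: Int_absorb1)

text \<open>Colourings of \<open>S\<close> are extensional functions, so that they form finite sets that can be
  counted. The set \<open>P e\<close> contains the forbidden colour patterns on the edge \<open>e\<close>.\<close>
definition avoiding_colorings :: "'a set set \<Rightarrow> ('a set \<Rightarrow> ('a \<Rightarrow> nat) set) \<Rightarrow> nat \<Rightarrow> 'a set \<Rightarrow> ('a \<Rightarrow> nat) set" where
  "avoiding_colorings E P N S = {c \<in> S \<rightarrow>\<^sub>E {..<N}. \<forall>e\<in>E. e \<subseteq> S \<longrightarrow> restrict c e \<notin> P e}"

lemma finite_avoiding_colorings: "finite S \<Longrightarrow> finite (avoiding_colorings E P N S)"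
  unfolding avoiding_colorings_def by (simp add: finite_PiE)

lemma restrict_avoiding_colorings:
  assumes "c \<in> avoiding_colorings E P N S" "T \<subseteq> S"
  shows "restrict c T \<in> avoiding_colorings E P N T"
  using assms
  by (auto simp: avoiding_colorings_def restrict_restrict_subset PiE_iff simp del: restrict_restrict)

text \<open>A colouring that becomes bad on \<open>e\<close> is determined by its forbidden pattern on \<open>e\<close> and a good
  colouring of the rest \<open>S - e\<close>.\<close>
lemma card_bad_extensions_le:
  assumes "finite S" "finite (P e)" "e \<subseteq> insert v S" "v \<in> e"
  shows "card {c \<in> insert v S \<rightarrow>\<^sub>E {..<N}. restrict c S \<in> avoiding_colorings E P N S \<and> restrict c e \<in> P e}
    \<le> card (avoiding_colorings E P N (S - e)) * card (P e)" (is "card ?C \<le> _")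
proof -
  let ?split = "\<lambda>c. (restrict c (S - e), restrict c e)"
  have "inj_on ?split ?C"
  proof (rule inj_onI)
    fix c d assume c: "c \<in> ?C" and d: "d \<in> ?C" and eq: "?split c = ?split d"
    have "c u = d u" if "u \<in> insert v S" for u
    proof (cases "u \<in> e")
      case True
      have "restrict c e u = restrict d e u" using eq by simp
      then show ?thesis using True by simp
    next
      case False
      then have "u \<in> S - e" using that assms(4) by auto
      moreover have "restrict c (S - e) u = restrict d (S - e) u" using eq by simp
      ultimately show ?thesis by simp
    qed
    then show "c = d" using c d by (auto intro: PiE_ext)
  qed
  moreover have "?split ` ?C \<subseteq> avoiding_colorings E P N (S - e) \<times> P e"
  proof
    fix q assume "q \<in> ?split ` ?C"
    then obtain c where c: "c \<in> ?C" "q = ?split c" by blast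
    then have "restrict (restrict c S) (S - e) \<in> avoiding_colorings E P N (S - e)"
      by (intro restrict_avoiding_colorings) auto
    then have "restrict c (S - e) \<in> avoiding_colorings E P N (S - e)"
      by (simp add: restrict_restrict_subset del: restrict_restrict)
    then show "q \<in> avoiding_colorings E P N (S - e) \<times> P e"
      using c by (simp add: restrict_restrict_subset del: restrict_restrict)
  qed
  ultimately have "card ?C \<le> card (avoiding_colorings E P N (S - e) \<times> P e)"
    using assms(1,2) by (intro card_inj_on_le[of ?split]) (auto simp: finite_avoiding_colorings)
  then show ?thesis by (simp add: card_cartesian_product)
qed

lemma card_extensions:
  assumes "v \<notin> S" "finite S"
  shows "card {c \<in> insert v S \<rightarrow>\<^sub>E {..<N}. restrict c S \<in> avoiding_colorings E P N S}
    = N * card (avoiding_colorings E P N S)"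
proof -
  let ?G = "avoiding_colorings E P N S"
  have sub: "?G \<subseteq> S \<rightarrow>\<^sub>E {..<N}" by (auto simp: avoiding_colorings_def)
  have restr: "restrict (g(v := y)) S = g" if "g \<in> ?G" for g y
    using that sub assms(1) by (fastforce simp: restrict_def PiE_def extensional_def)
  have "{c \<in> insert v S \<rightarrow>\<^sub>E {..<N}. restrict c S \<in> ?G} = (\<lambda>(y, g). g(v := y)) ` ({..<N} \<times> ?G)"
  proof (intro set_eqI iffI)
    fix c assume "c \<in> {c \<in> insert v S \<rightarrow>\<^sub>E {..<N}. restrict c S \<in> ?G}"
    then have c: "c \<in> insert v S \<rightarrow>\<^sub>E {..<N}" "restrict c S \<in> ?G" by auto
    have "c = (restrict c S)(v := c v)" using c(1) by (auto simp: restrict_def PiE_def extensional_def)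
    moreover have "c v \<in> {..<N}" using c(1) by blast
    ultimately show "c \<in> (\<lambda>(y, g). g(v := y)) ` ({..<N} \<times> ?G)"
      using c(2) by (intro image_eqI[of _ _ "(c v, restrict c S)"]) auto
  next
    fix c assume "c \<in> (\<lambda>(y, g). g(v := y)) ` ({..<N} \<times> ?G)"
    then obtain y g where g: "c = g(v := y)" "y < N" "g \<in> ?G" by auto
    then have "g \<in> S \<rightarrow>\<^sub>E {..<N}" using sub by blast
    then have "c \<in> insert v S \<rightarrow>\<^sub>E {..<N}" using g(1,2) by (auto simp: PiE_iff extensional_def)
    then show "c \<in> {c \<in> insert v S \<rightarrow>\<^sub>E {..<N}. restrict c S \<in> ?G}" using g restr by auto
  qed
  moreover have "inj_on (\<lambda>(y, g). g(v := y)) ({..<N} \<times> ?G)"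
  proof (rule inj_onI, clarify)
    fix y g y' g' assume "g \<in> ?G" "g' \<in> ?G" and eq: "g(v := y) = g'(v := y')"
    then show "y = y' \<and> g = g'" using restr by (metis fun_upd_same)
  qed
  ultimately show ?thesis by (simp add: card_image card_cartesian_product)
qed

text \<open>Adding a vertex multiplies the number of good colourings by at least \<open>\<beta>\<close>. By induction, the vertices of
  \<open>e\<close> other than \<open>v\<close> have contributed a factor \<open>\<beta> ^ (r - 1)\<close> on top of the good colourings of \<open>S - e\<close>. So at most a
  fraction \<open>B / \<beta> ^ (r - 1)\<close> of the count for \<open>S\<close> is lost to each of the at most \<open>D\<close> edges at \<open>v\<close>, out of the factor \<open>N\<close> that is
  available without restrictions.\<close>
lemma avoiding_colorings_growth:
  fixes \<beta> :: real
  assumes "finite E" and edges: "\<And>e. e \<in> E \<Longrightarrow> finite e \<and> card e = r"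
    and deg: "\<And>v. vertex_degree E v \<le> D"
    and P: "\<And>e. e \<in> E \<Longrightarrow> finite (P e) \<and> real (card (P e)) \<le> B"
    and "\<beta> > 0" "B \<ge> 0" and slack: "real D * B / \<beta> ^ (r - 1) \<le> real N - \<beta>"
  shows "finite S \<Longrightarrow> v \<notin> S \<Longrightarrow>
    \<beta> * real (card (avoiding_colorings E P N S)) \<le> real (card (avoiding_colorings E P N (insert v S)))"
proof (induction "card S" arbitrary: S v rule: less_induct)
  case less
  let ?G = "avoiding_colorings E P N"
  define ext where "ext = {c \<in> insert v S \<rightarrow>\<^sub>E {..<N}. restrict c S \<in> ?G S}"
  define F where "F = {e\<in>E. v \<in> e \<and> e \<subseteq> insert v S}"
  have grow: "\<beta> ^ card X * real (card (?G T)) \<le> real (card (?G (T \<union> X)))"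
    if "finite X" "T \<inter> X = {}" "T \<union> X \<subseteq> S" for T X
    using that
  proof (induction X rule: finite_induct)
    case empty
    then show ?case by simp
  next
    case (insert u X)
    have sub: "T \<union> X \<subset> S" using insert.prems insert.hyps(2) by auto
    have "\<beta> ^ card (insert u X) * real (card (?G T)) = \<beta> * (\<beta> ^ card X * real (card (?G T)))"
      using insert.hyps by simp
    also have "\<dots> \<le> \<beta> * real (card (?G (T \<union> X)))"
      using insert.IH insert.prems \<open>\<beta> > 0\<close> by (intro mult_left_mono) auto
    also have "\<dots> \<le> real (card (?G (insert u (T \<union> X))))"
      using insert.prems insert.hyps less.prems(1) sub
      by (intro less.hyps psubset_card_mono) (auto intro: finite_subset)
    finally show ?case by simp
  qed
  have bad: "real (card {c \<in> ext. restrict c e \<in> P e}) \<le> B / \<beta> ^ (r - 1) * real (card (?G S))" if e: "e \<in> F" for e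
  proof -
    have e': "e \<in> E" "v \<in> e" "e \<subseteq> insert v S" using e by (auto simp: F_def)
    have fin: "finite e" "card (e - {v}) = r - 1"
      using edges[OF e'(1)] e'(2) by (auto simp: card_Diff_singleton)
    have "S = (S - e) \<union> (e - {v})" using e'(2,3) less.prems(2) by auto
    then have "\<beta> ^ (r - 1) * real (card (?G (S - e))) \<le> real (card (?G S))"
      using grow[of "e - {v}" "S - e"] fin by auto
    then have "real (card (?G (S - e))) \<le> real (card (?G S)) / \<beta> ^ (r - 1)"
      using \<open>\<beta> > 0\<close> by (simp add: field_simps)
    moreover have "real (card {c \<in> ext. restrict c e \<in> P e}) \<le> real (card (?G (S - e)) * card (P e))"
      using card_bad_extensions_le[OF less.prems(1), of P e v N E] P[OF e'(1)] e'(2,3)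
      unfolding ext_def of_nat_le_iff by (simp add: conj_assoc)
    moreover have "real (card (?G (S - e)) * card (P e)) \<le> (real (card (?G S)) / \<beta> ^ (r - 1)) * B"
      unfolding of_nat_mult using calculation(1) P[OF e'(1)] \<open>B \<ge> 0\<close> by (intro mult_mono) (auto intro: order_trans)
    ultimately show ?thesis by (simp add: field_simps)
  qed
  have finF: "finite F" using \<open>finite E\<close> by (simp add: F_def)
  have fin_ext: "finite ext" using less.prems(1) by (simp add: ext_def finite_PiE)
  have "ext \<subseteq> ?G (insert v S) \<union> (\<Union>e\<in>F. {c \<in> ext. restrict c e \<in> P e})"
  proof
    fix c assume c: "c \<in> ext"
    show "c \<in> ?G (insert v S) \<union> (\<Union>e\<in>F. {c \<in> ext. restrict c e \<in> P e})"
    proof (cases "\<exists>e\<in>F. restrict c e \<in> P e")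
      case True
      then show ?thesis using c by blast
    next
      case False
      have "restrict c e \<notin> P e" if "e \<in> E" "e \<subseteq> insert v S" for e
      proof (cases "v \<in> e")
        case True
        then show ?thesis using False that by (auto simp: F_def)
      next
        case v: False
        then have "e \<subseteq> S" using that by auto
        then have "restrict (restrict c S) e \<notin> P e"
          using c that by (auto simp: ext_def avoiding_colorings_def simp del: restrict_restrict)
        then show ?thesis using \<open>e \<subseteq> S\<close> by (simp add: restrict_restrict_subset del: restrict_restrict)
      qed
      then show ?thesis using c by (auto simp: ext_def avoiding_colorings_def)
    qed
  qed
  then have "card ext \<le> card (?G (insert v S) \<union> (\<Union>e\<in>F. {c \<in> ext. restrict c e \<in> P e}))"
    using finF fin_ext less.prems(1) by (intro card_mono) (auto simp: finite_avoiding_colorings)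
  also have "\<dots> \<le> card (?G (insert v S)) + (\<Sum>e\<in>F. card {c \<in> ext. restrict c e \<in> P e})"
    by (intro order.trans[OF card_Un_le] add_left_mono card_UN_le finF)
  finally have "real (card ext) \<le> real (card (?G (insert v S)) + (\<Sum>e\<in>F. card {c \<in> ext. restrict c e \<in> P e}))"
    by (simp only: of_nat_le_iff)
  then have "real (card ext) \<le> real (card (?G (insert v S))) + (\<Sum>e\<in>F. real (card {c \<in> ext. restrict c e \<in> P e}))"
    by (simp only: of_nat_add of_nat_sum)
  also have "(\<Sum>e\<in>F. real (card {c \<in> ext. restrict c e \<in> P e})) \<le> real (card F) * (B / \<beta> ^ (r - 1) * real (card (?G S)))"
    using bad by (rule sum_bounded_above)
  also have "\<dots> \<le> real D * (B / \<beta> ^ (r - 1) * real (card (?G S)))"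
  proof (intro mult_right_mono)
    have "card F \<le> vertex_degree E v"
      unfolding vertex_degree_def F_def using \<open>finite E\<close> by (intro card_mono) auto
    then show "real (card F) \<le> real D" using deg[of v] by simp
  qed (use \<open>B \<ge> 0\<close> \<open>\<beta> > 0\<close> in auto)
  also have "\<dots> = real D * B / \<beta> ^ (r - 1) * real (card (?G S))" by simp
  also have "\<dots> \<le> (real N - \<beta>) * real (card (?G S))" by (intro mult_right_mono slack) simp
  finally have "real (card ext) \<le> real (card (?G (insert v S))) + (real N - \<beta>) * real (card (?G S))" by simp
  moreover have "real (card ext) = real N * real (card (?G S))"
    using card_extensions[OF less.prems(2,1)] by (simp add: ext_def)
  ultimately show ?case by (simp add: algebra_simps)
qed

text \<open>The condition says that a random colouring spoils a given edge with probability at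
  most \<open>1 / (e r D)\<close>, as in the local lemma.\<close>
lemma ex_avoiding_coloring:
  fixes B :: real
  assumes "finite V" "finite E" and edges: "\<And>e. e \<in> E \<Longrightarrow> finite e \<and> card e = r" and "r \<ge> 2"
    and deg: "\<And>v. vertex_degree E v \<le> D"
    and P: "\<And>e. e \<in> E \<Longrightarrow> finite (P e) \<and> real (card (P e)) \<le> B"
    and "N > 0" "B \<ge> 0" and small: "exp 1 * real r * real D * B \<le> real N ^ r"
  shows "\<exists>c \<in> V \<rightarrow>\<^sub>E {..<N}. \<forall>e\<in>E. e \<subseteq> V \<longrightarrow> restrict c e \<notin> P e"
proof -
  define n where "n = r - 1"
  have n: "n \<ge> 1" "r = Suc n" using \<open>r \<ge> 2\<close> by (auto simp: n_def)
  \<comment> \<open>The choice \<open>\<beta> = N (1 - 1 / r)\<close> maximizes \<open>\<beta> ^ (r - 1) (N - \<beta>)\<close>.\<close>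
  define \<beta> where "\<beta> = real N * (real n / real r)"
  have \<beta>: "\<beta> > 0" using \<open>N > 0\<close> n by (simp add: \<beta>_def)
  have "(real r / real n) ^ n = (1 + 1 / real n) ^ n" using n by (simp add: field_simps)
  also have "\<dots> \<le> exp (1 / real n) ^ n" by (intro power_mono) auto
  also have "\<dots> = exp 1" using n by (simp flip: exp_of_nat_mult)
  finally have e: "(real r / real n) ^ n \<le> exp 1" .
  have "real D * B / \<beta> ^ n \<le> real N - \<beta>"
  proof -
    have "real D * B / \<beta> ^ n = real D * B * (real r / real n) ^ n / real N ^ n"
      by (simp add: \<beta>_def power_mult_distrib power_divide)
    also have "\<dots> \<le> real D * B * exp 1 / real N ^ n"
      using e \<open>B \<ge> 0\<close> by (intro divide_right_mono mult_left_mono) auto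
    also have "\<dots> \<le> real N / real r"
      using small \<open>N > 0\<close> n by (simp add: field_simps)
    also have "\<dots> = real N - \<beta>" using n by (simp add: \<beta>_def field_simps)
    finally show ?thesis .
  qed
  then have slack: "real D * B / \<beta> ^ (r - 1) \<le> real N - \<beta>" by (simp add: n_def)
  have growth: "\<beta> * real (card (avoiding_colorings E P N S)) \<le> real (card (avoiding_colorings E P N (insert v S)))"
    if "finite S" "v \<notin> S" for S v
    using avoiding_colorings_growth[where E = E and P = P and N = N, OF \<open>finite E\<close> edges deg P \<beta> \<open>B \<ge> 0\<close> slack that] .
  have "avoiding_colorings E P N V \<noteq> {}"
    using \<open>finite V\<close>
  proof (induction V rule: finite_induct)
    case empty
    have "e \<noteq> {}" if "e \<in> E" for e using edges[OF that] \<open>r \<ge> 2\<close> by auto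
    then show ?case by (auto simp: avoiding_colorings_def)
  next
    case (insert v S)
    then have "card (avoiding_colorings E P N S) > 0" 
      using finite_avoiding_colorings by (metis card_gt_0_iff)
    then have "0 < \<beta> * real (card (avoiding_colorings E P N S))" using \<beta> by simp
    then have "card (avoiding_colorings E P N (insert v S)) \<noteq> 0"
      using growth[OF insert.hyps(1,2)] by auto
    then show ?case by auto
  qed
  then show ?thesis by (auto simp: avoiding_colorings_def)
qed

section \<open>Patterns without a unique real colour\<close>

text \<open>The colours below \<open>z\<close> are blank: all of them are later identified with one
  colour, so a blank colour that occurs once does not count as unique. The other \<open>k\<close> colours are real. Having
  \<open>z\<close> blank colours amounts to choosing the blank with weight \<open>z\<close> in a uniform count.\<close>
definition singleton_free :: "nat \<Rightarrow> nat \<Rightarrow> 'a set \<Rightarrow> ('a \<Rightarrow> nat) set" where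
  "singleton_free z k A = {g \<in> A \<rightarrow>\<^sub>E {..<z + k}. \<forall>q\<in>{z..<z + k}. card {a\<in>A. g a = q} \<noteq> 1}"

lemma finite_singleton_free: "finite A \<Longrightarrow> finite (singleton_free z k A)"
  by (simp add: singleton_free_def finite_PiE)

text \<open>Split a pattern into the set \<open>J\<close> of positions that carry the largest real colour and the
  pattern on the remaining positions.\<close>
lemma card_singleton_free_Suc_le:
  assumes "finite A"
  shows "card (singleton_free z (Suc k) A) \<le> (\<Sum>J | J \<subseteq> A \<and> card J \<noteq> 1. card (singleton_free z k (A - J)))"
proof -
  let ?fibre = "\<lambda>g. {a\<in>A. g a = z + k}"
  let ?f = "\<lambda>g. (?fibre g, restrict g (A - ?fibre g))"
  let ?X = "SIGMA J : {J. J \<subseteq> A \<and> card J \<noteq> 1}. singleton_free z k (A - J)"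
  have "inj_on ?f (singleton_free z (Suc k) A)"
  proof (rule inj_onI)
    fix g h assume gh: "g \<in> singleton_free z (Suc k) A" "h \<in> singleton_free z (Suc k) A" "?f g = ?f h"
    have fibre: "?fibre g = ?fibre h" and rest: "restrict g (A - ?fibre g) = restrict h (A - ?fibre h)"
      using gh(3) by blast+
    have "g a = h a" if "a \<in> A" for a
    proof (cases "a \<in> ?fibre g")
      case True
      then have "a \<in> ?fibre h" using fibre by metis
      then show ?thesis using True by simp
    next
      case False
      then have "a \<notin> ?fibre h" using fibre by metis
      then show ?thesis using fun_cong[OF rest, of a] False that by simp
    qed
    then show "g = h" using gh(1,2) by (auto simp: singleton_free_def intro: PiE_ext)
  qed
  moreover have "?f ` singleton_free z (Suc k) A \<subseteq> ?X"
  proof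
    fix q assume "q \<in> ?f ` singleton_free z (Suc k) A"
    then obtain g where g: "g \<in> singleton_free z (Suc k) A" "q = ?f g" by blast
    have rng: "g a < z + k" if "a \<in> A" "g a \<noteq> z + k" for a
    proof -
      have "g a < z + Suc k" using g(1) that(1) by (auto simp: singleton_free_def)
      then show ?thesis using that(2) by simp
    qed
    have "card {a \<in> A - ?fibre g. restrict g (A - ?fibre g) a = p} \<noteq> 1" if p: "p \<in> {z..<z + k}" for p
    proof -
      have "{a \<in> A - ?fibre g. restrict g (A - ?fibre g) a = p} = {a\<in>A. g a = p}" using p by auto
      then show ?thesis using g(1) p by (auto simp: singleton_free_def)
    qed
    then have "restrict g (A - ?fibre g) \<in> singleton_free z k (A - ?fibre g)"
      using rng by (auto simp: singleton_free_def)
    moreover have "card (?fibre g) \<noteq> 1" using g(1) by (auto simp: singleton_free_def)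
    ultimately show "q \<in> ?X" using g(2) by auto
  qed
  moreover have "finite {J. J \<subseteq> A \<and> card J \<noteq> 1}" using assms by (auto intro: finite_subset[of _ "Pow A"])
  then have "finite ?X" using assms by (auto intro!: finite_SigmaI finite_singleton_free)
  ultimately have "card (singleton_free z (Suc k) A) \<le> card ?X" by (rule card_inj_on_le)
  also have "card ?X = (\<Sum>J | J \<subseteq> A \<and> card J \<noteq> 1. card (singleton_free z k (A - J)))"
    using \<open>finite {J. J \<subseteq> A \<and> card J \<noteq> 1}\<close> assms by (intro card_SigmaI) (auto intro: finite_singleton_free)
  finally show ?thesis .
qed

lemma sum_subsets_by_card:
  fixes f :: "nat \<Rightarrow> real"
  assumes "finite A"
  shows "(\<Sum>J | J \<subseteq> A \<and> card J \<noteq> 1. f (card J)) = (\<Sum>j\<in>{..card A} - {1}. real (card A choose j) * f j)"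
proof -
  let ?S = "{J. J \<subseteq> A \<and> card J \<noteq> 1}"
  have "finite ?S" using assms by (auto intro: finite_subset[of _ "Pow A"])
  moreover have "card ` ?S \<subseteq> {..card A} - {1}" using assms by (auto intro: card_mono)
  ultimately have "(\<Sum>J\<in>?S. f (card J)) = (\<Sum>j\<in>{..card A} - {1}. \<Sum>J | J \<in> ?S \<and> card J = j. f (card J))"
    by (intro sum.group[symmetric]) auto
  also have "\<dots> = (\<Sum>j\<in>{..card A} - {1}. real (card A choose j) * f j)"
  proof (rule sum.cong)
    fix j assume "j \<in> {..card A} - {1}"
    then have "{J. J \<in> ?S \<and> card J = j} = {J. J \<subseteq> A \<and> card J = j}" by auto
    then show "(\<Sum>J | J \<in> ?S \<and> card J = j. f (card J)) = real (card A choose j) * f j"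
      using n_subsets[OF assms, of j] by simp
  qed simp
  finally show ?thesis .
qed

lemma exp_partial_sum_le:
  fixes x :: real
  assumes "x \<ge> 0" "finite J"
  shows "(\<Sum>j\<in>J. x ^ j / fact j) \<le> exp x"
proof -
  have "(\<Sum>j\<in>J. x ^ j /\<^sub>R fact j) \<le> (\<Sum>j. x ^ j /\<^sub>R fact j)"
    using assms by (intro sum_le_suminf summable_exp_generic) auto
  then show ?thesis by (simp add: exp_def divide_inverse mult.commute)
qed

text \<open>The numbers \<open>a n\<close> of singleton-free patterns on \<open>n\<close> positions have the exponential generating function
  \<open>exp (z x) (exp x - x) ^ k\<close>, as each real colour contributes \<open>exp x\<close> without its linear term. All
  coefficients are nonnegative, so a single term \<open>a n x ^ n / n!\<close> is at most the value of the function. The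
  induction on \<open>k\<close> proves this bound directly, without manipulating power series.\<close>
lemma card_singleton_free_le:
  fixes x :: real
  assumes "x > 0" "finite A"
  shows "real (card (singleton_free z k A)) * (x ^ card A / fact (card A)) \<le> exp (real z * x) * (exp x - x) ^ k"
  using assms(2)
proof (induction k arbitrary: A)
  case 0
  have "singleton_free z 0 A = A \<rightarrow>\<^sub>E {..<z}" by (auto simp: singleton_free_def)
  then have "card (singleton_free z 0 A) = z ^ card A" using 0 by (simp add: card_PiE)
  then have "real (card (singleton_free z 0 A)) * (x ^ card A / fact (card A)) = (real z * x) ^ card A / fact (card A)"
    by (simp add: power_mult_distrib)
  also have "\<dots> \<le> exp (real z * x)"
    using exp_partial_sum_le[of "real z * x" "{card A}"] assms(1) by simp
  finally show ?case by simp
next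
  case (Suc k)
  define n where "n = card A"
  define M where "M = exp (real z * x) * (exp x - x) ^ k"
  have "exp x - x \<ge> 0" using exp_ge_add_one_self[of x] by linarith
  then have "M \<ge> 0" by (simp add: M_def)
  have summand: "real (card (singleton_free z k (A - J))) \<le> M * (fact (n - card J) / x ^ (n - card J))"
    if "J \<subseteq> A" for J
  proof -
    have c: "card (A - J) = n - card J" using that Suc.prems by (simp add: n_def card_Diff_subset finite_subset)
    have "real (card (singleton_free z k (A - J))) * (x ^ (n - card J) / fact (n - card J)) \<le> M"
      using Suc.IH[of "A - J"] Suc.prems unfolding c M_def by simp
    then show ?thesis using assms(1) by (simp add: field_simps)
  qed
  have "real (card (singleton_free z (Suc k) A)) \<le> (\<Sum>J | J \<subseteq> A \<and> card J \<noteq> 1. real (card (singleton_free z k (A - J))))"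
    using card_singleton_free_Suc_le[OF Suc.prems, of z k] by (simp only: of_nat_le_iff flip: of_nat_sum)
  also have "\<dots> \<le> (\<Sum>J | J \<subseteq> A \<and> card J \<noteq> 1. M * (fact (n - card J) / x ^ (n - card J)))"
    using summand by (intro sum_mono) auto
  also have "\<dots> = (\<Sum>j\<in>{..n} - {1}. real (n choose j) * (M * (fact (n - j) / x ^ (n - j))))"
    unfolding n_def by (rule sum_subsets_by_card[OF Suc.prems])
  finally have "real (card (singleton_free z (Suc k) A)) * (x ^ n / fact n) \<le>
      (\<Sum>j\<in>{..n} - {1}. real (n choose j) * (M * (fact (n - j) / x ^ (n - j)))) * (x ^ n / fact n)"
    using assms(1) by (intro mult_right_mono) auto
  also have "\<dots> = (\<Sum>j\<in>{..n} - {1}. M * (x ^ j / fact j))"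
    unfolding sum_distrib_right
  proof (rule sum.cong)
    have cancel: "(a / (b * c)) * (M * (c / q)) * ((p * q) / a) = M * (p / b)"
      if "a \<noteq> 0" "c \<noteq> 0" "q \<noteq> 0" for a b c p q :: real
      using that by simp
    fix j assume "j \<in> {..n} - {1}"
    then have "j \<le> n" by auto
    then have "real (n choose j) = fact n / (fact j * fact (n - j))" by (rule binomial_fact)
    moreover have "x ^ n = x ^ j * x ^ (n - j)" using \<open>j \<le> n\<close> by (simp flip: power_add)
    ultimately show "real (n choose j) * (M * (fact (n - j) / x ^ (n - j))) * (x ^ n / fact n) = M * (x ^ j / fact j)"
      using assms(1) cancel[of "fact n" "fact (n - j)" "x ^ (n - j)" "fact j" "x ^ j"] by simp
  qed simp
  also have "\<dots> = M * (\<Sum>j\<in>{..n} - {1}. x ^ j / fact j)" by (simp add: sum_distrib_left)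
  also have "\<dots> \<le> M * (exp x - x)"
  proof (intro mult_left_mono \<open>M \<ge> 0\<close>)
    have "x + (\<Sum>j\<in>{..n} - {1}. x ^ j / fact j) = (\<Sum>j\<in>insert 1 ({..n} - {1}). x ^ j / fact j)"
      by (subst sum.insert) auto
    also have "\<dots> \<le> exp x" using assms(1) by (intro exp_partial_sum_le) auto
    finally show "(\<Sum>j\<in>{..n} - {1}. x ^ j / fact j) \<le> exp x - x" by simp
  qed
  finally show ?case by (simp add: n_def M_def mult_ac)
qed

section \<open>Degrees at least logarithmic in the edge size\<close>

text \<open>A crude form of Stirling's formula; the induction step is \<open>exp 1 \<le> (1 + 1 / n) ^ (n + 1)\<close>.\<close>
lemma fact_le_exp:
  assumes "n \<ge> 1"
  shows "fact n \<le> real n * exp 1 * (real n / exp 1) ^ n"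
  using assms
proof (induction n rule: nat_induct_at_least)
  case base
  then show ?case by simp
next
  case (Suc n)
  have n: "real n > 0" using Suc.hyps by simp
  have "exp 1 \<le> (1 + 1 / real n) ^ Suc n"
  proof -
    have "1 + 1 / real n = 1 / (1 - 1 / real (Suc n))" using n by (simp add: field_simps)
    moreover have "1 - 1 / real (Suc n) \<le> exp (- (1 / real (Suc n)))"
      using exp_ge_add_one_self[of "- (1 / real (Suc n))"] by simp
    moreover have "1 - 1 / real (Suc n) > 0" using n by simp
    ultimately have "exp (1 / real (Suc n)) \<le> 1 + 1 / real n"
      by (simp add: exp_minus field_simps)
    then have "exp (1 / real (Suc n)) ^ Suc n \<le> (1 + 1 / real n) ^ Suc n"
      by (intro power_mono) auto
    moreover have "exp (1 / real (Suc n)) ^ Suc n = exp 1"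
      by (subst exp_of_nat_mult[symmetric]) simp
    ultimately show ?thesis by simp
  qed
  then have "exp 1 * real n ^ Suc n \<le> (1 + 1 / real n) ^ Suc n * real n ^ Suc n"
    by (intro mult_right_mono) auto
  also have "\<dots> = real (Suc n) ^ Suc n"
    using n by (simp add: field_simps flip: power_mult_distrib)
  finally have step: "exp 1 * real n ^ Suc n \<le> real (Suc n) ^ Suc n" .
  have "fact (Suc n) = real (Suc n) * fact n" by simp
  also have "\<dots> \<le> real (Suc n) * (real n * exp 1 * (real n / exp 1) ^ n)"
    using Suc.IH by (intro mult_left_mono) auto
  also have "\<dots> = real (Suc n) * (exp 1 * real n ^ Suc n) / exp 1 ^ n" by (simp add: power_divide)
  also have "\<dots> \<le> real (Suc n) * real (Suc n) ^ Suc n / exp 1 ^ n"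
    using step by (intro divide_right_mono mult_left_mono) auto
  also have "\<dots> = real (Suc n) * exp 1 * (real (Suc n) / exp 1) ^ Suc n"
    by (simp add: power_divide)
  finally show ?case .
qed

text \<open>All blank colours are merged into the colour \<open>k\<close>. The parameter \<open>x\<close> is free and is chosen to make the
  generating-function bound as strong as needed.\<close>
lemma ex_coloring_of_palette:
  fixes x :: real
  assumes H: "hypergraph V E" "uniform_edges r E" and "r \<ge> 2" "max_degree V E \<le> D" "x > 0" "z + k > 0"
    and small: "exp 1 * real r * real D * (fact r * (exp (real z * x) * (exp x - x) ^ k)) \<le> (real (z + k) * x) ^ r"
  shows "\<exists>col. conflict_free E col \<and> (\<forall>v\<in>V. col v < k + (if z = 0 then 0 else 1))"
proof -
  define M where "M = exp (real z * x) * (exp x - x) ^ k"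
  have "exp x - x \<ge> 0" using exp_ge_add_one_self[of x] by linarith
  then have M: "M \<ge> 0" by (simp add: M_def)
  define B where "B = fact r * M / x ^ r"
  have fin: "finite e" "card e = r" if "e \<in> E" for e
  proof -
    have "finite V" "e \<subseteq> V" using H(1) that by (auto simp: hypergraph_def)
    then show "finite e" by (rule finite_subset[rotated])
    show "card e = r" using H(2) that by (simp add: uniform_edges_def)
  qed
  have patterns: "finite (singleton_free z k e) \<and> real (card (singleton_free z k e)) \<le> B" if "e \<in> E" for e
  proof -
    have "real (card (singleton_free z k e)) * (x ^ r / fact r) \<le> M"
      using card_singleton_free_le[OF \<open>x > 0\<close> fin(1)[OF that], of z k] fin(2)[OF that] by (simp add: M_def)
    then show ?thesis using \<open>x > 0\<close> fin(1)[OF that] by (simp add: B_def field_simps finite_singleton_free)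
  qed
  have "exp 1 * real r * real D * B \<le> real (z + k) ^ r"
    using small \<open>x > 0\<close> unfolding B_def M_def[symmetric] power_mult_distrib by (simp add: field_simps)
  moreover have "vertex_degree E v \<le> D" for v
    using vertex_degree_le_max_degree[OF H(1), of v] assms(4) by simp
  moreover have "B \<ge> 0" using M \<open>x > 0\<close> by (simp add: B_def)
  moreover have "finite V" using H(1) by (simp add: hypergraph_def)
  ultimately obtain c where c: "c \<in> V \<rightarrow>\<^sub>E {..<z + k}" "\<forall>e\<in>E. e \<subseteq> V \<longrightarrow> restrict c e \<notin> singleton_free z k e"
    using ex_avoiding_coloring[of V E r D "singleton_free z k" B "z + k"] finite_edges[OF H(1)] fin patterns
      \<open>r \<ge> 2\<close> \<open>z + k > 0\<close> by blast
  define col where "col v = (if c v < z then k else c v - z)" for v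
  have "\<exists>v\<in>e. \<forall>w\<in>e. w \<noteq> v \<longrightarrow> col w \<noteq> col v" if e: "e \<in> E" for e
  proof -
    have eV: "e \<subseteq> V" using H(1) e by (auto simp: hypergraph_def)
    then have "restrict c e \<in> e \<rightarrow>\<^sub>E {..<z + k}" using c(1) by auto
    moreover have "restrict c e \<notin> singleton_free z k e" using c(2) e eV by blast
    ultimately obtain q where q: "q \<in> {z..<z + k}" "card {a\<in>e. restrict c e a = q} = 1"
      by (auto simp: singleton_free_def)
    moreover have "{a\<in>e. restrict c e a = q} = {a\<in>e. c a = q}" by auto
    ultimately obtain v where v: "{a\<in>e. c a = q} = {v}" by (metis card_1_singletonE)
    have "v \<in> e" "c v = q" using v by auto
    moreover have "col w \<noteq> col v" if "w \<in> e" "w \<noteq> v" for w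
    proof -
      have "c w \<noteq> q" using v that by blast
      then show ?thesis using q(1) \<open>c v = q\<close> by (auto simp: col_def)
    qed
    ultimately show ?thesis by blast
  qed
  then have "conflict_free E col" by (simp add: conflict_free_def)
  moreover have "col v < k + (if z = 0 then 0 else 1)" if "v \<in> V" for v
  proof -
    have "c v < z + k" using c(1) that by blast
    then show ?thesis by (auto simp: col_def)
  qed
  ultimately show ?thesis by blast
qed

text \<open>With \<open>k = D - 1\<close> real colours, \<open>r\<close> colours in total and \<open>x = 1\<close>, the factors \<open>r ^ r\<close> and \<open>exp r\<close> cancel and
  an edge is bad with probability at most \<open>(1 - 1 / exp 1) ^ k\<close> times a power of \<open>r\<close>. This is polynomially small in \<open>r\<close> of any desired degree once
  \<open>D\<close> is a large multiple of \<open>ln r\<close>.\<close>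
lemma palette_bound_small_degree:
  fixes r D :: nat
  assumes "r \<ge> 3" "D \<le> r" "real D \<ge> 16 * ln (real r)"
  shows "exp 1 * real r * real D * (fact r * (exp (real (r - (D - 1)) * 1) * (exp 1 - 1) ^ (D - 1)))
    \<le> (real (r - (D - 1) + (D - 1)) * 1) ^ r"
proof -
  define k where "k = D - 1"
  have lnr: "ln (real r) \<ge> 1"
  proof -
    have "exp 1 \<le> real r" using exp_le assms(1) by linarith
    then show ?thesis using assms(1) by (subst ln_ge_iff) auto
  qed
  have "D \<ge> 1" using assms(3) lnr by linarith
  then have k: "real k = real D - 1" "k \<le> r" using assms(2) by (auto simp: k_def)
  \<comment> \<open>The exponent 5 leaves \<open>r ^ 2\<close> to spare against \<open>r ^ 3\<close>, enough to absorb \<open>exp 2\<close>; it comes from \<open>k \<ge> 15 ln r\<close>.\<close>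
  have "(1 - exp (-1)) ^ k \<le> exp (- (1 / 3) :: real) ^ k"
  proof (intro power_mono)
    have "exp (-1) \<ge> (1 / 3 :: real)" using exp_le by (simp add: exp_minus field_simps)
    then show "1 - exp (-1) \<le> exp (- (1 / 3) :: real)"
      using exp_ge_add_one_self[of "- (1 / 3) :: real"] by linarith
  qed simp
  also have "\<dots> = exp (- (real k / 3))" by (simp flip: exp_of_nat_mult)
  also have "\<dots> \<le> exp (- (5 * ln (real r)))"
    using k(1) assms(3) lnr by simp
  finally have q: "(1 - exp (-1)) ^ k \<le> exp (- (5 * ln (real r)))" .
  have r3: "real r ^ 3 = exp (3 * ln (real r))"
    using assms(1) by (simp add: exp_of_nat_mult[of 3, simplified])
  have "exp 1 * real r * real D * (fact r * (exp (real (r - k)) * (exp 1 - 1) ^ k))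
     \<le> exp 1 * real r * real r * ((real r * exp 1 * (real r / exp 1) ^ r) * (exp (real (r - k)) * (exp 1 - 1) ^ k))"
    using assms(1,2) fact_le_exp[of r]
    by (intro mult_mono mult_nonneg_nonneg zero_le_power) auto
  also have "\<dots> = exp 2 * real r ^ 3 * (1 - exp (-1)) ^ k * real r ^ r"
  proof -
    have "exp (real (r - k)) = exp 1 ^ r / exp 1 ^ k"
      using k(2) by (simp add: of_nat_diff exp_diff flip: exp_of_nat_mult)
    moreover have "(exp 1 - 1) ^ k / exp 1 ^ k = ((1 - exp (-1)) ^ k :: real)"
      by (simp add: exp_minus diff_divide_distrib inverse_eq_divide flip: power_divide)
    moreover have "exp 2 = exp 1 * (exp 1 :: real)" by (simp flip: exp_add)
    ultimately show ?thesis by (simp add: power_divide power3_eq_cube field_simps)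
  qed
  also have "\<dots> \<le> exp 2 * exp (3 * ln (real r)) * exp (- (5 * ln (real r))) * real r ^ r"
    unfolding r3 using q by (intro mult_right_mono mult_left_mono) auto
  also have "exp 2 * exp (3 * ln (real r)) * exp (- (5 * ln (real r))) = exp (2 - 2 * ln (real r))"
    by (simp flip: exp_add)
  also have "exp (2 - 2 * ln (real r)) * real r ^ r \<le> 1 * real r ^ r"
    using lnr by (intro mult_right_mono) auto
  finally show ?thesis using k(2) by (simp add: k_def)
qed

text \<open>Here all \<open>D\<close> colours are real and \<open>x\<^sup>2 = r / (2 D)\<close>, which minimizes \<open>exp (D x\<^sup>2) / x ^ r\<close>; note that
  \<open>exp x - x \<le> 1 + x\<^sup>2\<close>. With \<open>y = D / r\<close> the claim becomes, up to a factor \<open>exp 2 r ^ 3\<close>, that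
  \<open>y exp (- r / 2) \<le> (y / 2) ^ (r / 2)\<close>, where the exponential gap comes from \<open>2 < exp 1\<close>.\<close>
lemma palette_bound_large_degree:
  fixes r D :: nat
  assumes "r \<ge> 2" "r \<le> D" and r: "exp 2 * real r ^ 3 \<le> exp (real r / 10)"
    and x: "x = sqrt (real r / (2 * real D))"
  shows "exp 1 * real r * real D * (fact r * (exp (real 0 * x) * (exp x - x) ^ D)) \<le> (real (0 + D) * x) ^ r"
proof -
  define y where "y = real D / real r"
  have y: "y \<ge> 1" "real D = real r * y" using assms(1,2) by (auto simp: y_def)
  have x2: "x\<^sup>2 = 1 / (2 * y)" using assms(1,2) by (simp add: x y_def)
  have x0: "x > 0" using assms(1,2) by (simp add: x)
  have x1: "x \<le> 1"
  proof (rule power2_le_imp_le)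
    show "x\<^sup>2 \<le> 1\<^sup>2" unfolding x2 using y(1) by simp
  qed simp
  have "(exp x - x) ^ D \<le> exp (x\<^sup>2) ^ D"
  proof (intro power_mono)
    have "exp x \<le> 1 + x + x\<^sup>2" using exp_bound[of x] x0 x1 by simp
    then show "exp x - x \<le> exp (x\<^sup>2)" using exp_ge_add_one_self[of "x\<^sup>2"] by linarith
    show "0 \<le> exp x - x" using exp_ge_add_one_self[of x] by linarith
  qed
  also have "\<dots> = exp (real r / 2)"
    using y by (simp add: x2 flip: exp_of_nat_mult)
  finally have e: "(exp x - x) ^ D \<le> exp (real r / 2)" .
  have half: "exp (- (2 / 5)) * sqrt y \<le> y * x"
  proof (rule power2_le_imp_le)
    have "(2 :: real) \<le> exp (4 / 5)" using exp_lower_Taylor_quadratic[of "4 / 5 :: real"] by (simp add: power2_eq_square)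
    then have "exp (- (4 / 5)) \<le> (1 / 2 :: real)" by (simp add: exp_minus field_simps)
    then have "exp (- (4 / 5)) * y \<le> 1 / 2 * y" using y(1) by (intro mult_right_mono) auto
    moreover have "(exp (- (2 / 5)) * sqrt y)\<^sup>2 = exp (- (4 / 5)) * y"
    proof -
      have "exp (- (2 / 5)) ^ 2 = exp (- (4 / 5) :: real)" by (simp add: power2_eq_square flip: exp_add)
      then show ?thesis using y(1) by (simp only: power_mult_distrib) simp
    qed
    moreover have "(y * x)\<^sup>2 = 1 / 2 * y" using y(1) x2 by (simp add: power_mult_distrib power2_eq_square field_simps)
    ultimately show "(exp (- (2 / 5)) * sqrt y)\<^sup>2 \<le> (y * x)\<^sup>2" by simp
  qed (use y(1) x0 in simp)
  have "y = sqrt y ^ 2" using y(1) by simp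
  also have "\<dots> \<le> sqrt y ^ r" using y(1) assms(1) by (intro power_increasing) auto
  finally have sy: "y \<le> sqrt y ^ r" .
  have "exp 1 * real r * real D * (fact r * (exp (real 0 * x) * (exp x - x) ^ D))
      \<le> exp 1 * real r * real D * ((real r * exp 1 * (real r / exp 1) ^ r) * exp (real r / 2))"
  proof (intro mult_mono)
    show "fact r \<le> real r * exp 1 * (real r / exp 1) ^ r" using assms(1) by (intro fact_le_exp) simp
    show "exp (real 0 * x) * (exp x - x) ^ D \<le> exp (real r / 2)" using e by simp
    have "0 \<le> exp x - x" using exp_ge_add_one_self[of x] by linarith
    then show "0 \<le> exp (real 0 * x) * (exp x - x) ^ D" "0 \<le> fact r * (exp (real 0 * x) * (exp x - x) ^ D)" by auto
  qed auto
  also have "\<dots> = (exp 2 * real r ^ 3) * exp (- (real r / 2)) * y * real r ^ r"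
  proof -
    have "exp 1 ^ r = exp (real r / 2) * exp (real r / 2)" by (simp flip: exp_of_nat_mult exp_add)
    then have "(real r / exp 1) ^ r * exp (real r / 2) = real r ^ r * exp (- (real r / 2))"
      by (simp add: power_divide exp_minus field_simps)
    moreover have "exp 2 = exp 1 * (exp 1 :: real)" by (simp flip: exp_add)
    ultimately show ?thesis unfolding y(2) by (simp add: power3_eq_cube)
  qed
  also have "\<dots> \<le> exp (real r / 10) * exp (- (real r / 2)) * sqrt y ^ r * real r ^ r"
    using r sy y(1) by (intro mult_mono) auto
  also have "exp (real r / 10) * exp (- (real r / 2)) = exp (- (2 / 5)) ^ r"
    by (simp flip: exp_add exp_of_nat_mult)
  also have "exp (- (2 / 5)) ^ r * sqrt y ^ r * real r ^ r = (exp (- (2 / 5)) * sqrt y) ^ r * real r ^ r"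
    by (simp add: power_mult_distrib)
  also have "\<dots> \<le> (y * x) ^ r * real r ^ r"
    using half y(1) by (intro mult_right_mono power_mono) auto
  also have "\<dots> = (real (0 + D) * x) ^ r" using y(2) by (simp add: power_mult_distrib)
  finally show ?thesis .
qed

theorem f_cf_le_of_log_degree:
  "\<exists>c c\<^sub>0 :: real. c > 0 \<and> c\<^sub>0 > 0 \<and>
    (\<forall>r \<Delta> :: nat. r > 0 \<and> \<Delta> > 0 \<and> real r \<ge> c \<and> real \<Delta> \<ge> c\<^sub>0 * ln (real r) \<longrightarrow> f_cf r \<Delta> \<le> \<Delta>)"
proof -
  have "eventually (\<lambda>r :: nat. exp 2 * real r ^ 3 \<le> exp (real r / 10)) at_top" by real_asymp
  then obtain r0 where r0: "\<And>r. r \<ge> r0 \<Longrightarrow> exp 2 * real r ^ 3 \<le> exp (real r / 10)"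
    by (auto simp: eventually_at_top_linorder)
  have main: "f_cf r \<Delta> \<le> \<Delta>" if r: "r \<ge> max r0 3" and \<Delta>: "\<Delta> > 0" "real \<Delta> \<ge> 16 * ln (real r)" for r \<Delta>
  proof (rule f_cf_le)
    show "r \<ge> 2" using r by simp
    fix V :: "nat set" and E
    assume H: "hypergraph V E" "uniform_edges r E" "max_degree V E = \<Delta>"
    have "\<exists>col. conflict_free E col \<and> (\<forall>v\<in>V. col v < \<Delta>)"
    proof (cases "\<Delta> \<le> r")
      case True
      have "\<exists>col. conflict_free E col \<and> (\<forall>v\<in>V. col v < (\<Delta> - 1) + (if r - (\<Delta> - 1) = 0 then 0 else 1))"
        using r H(3) True palette_bound_small_degree[OF _ True \<Delta>(2)]
        by (intro ex_coloring_of_palette[OF H(1,2), where x = 1 and D = \<Delta>]) auto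
      moreover have "(\<Delta> - 1) + (if r - (\<Delta> - 1) = 0 then 0 else 1) = \<Delta>" using True \<Delta>(1) by auto
      ultimately show ?thesis by metis
    next
      case False
      have "\<exists>col. conflict_free E col \<and> (\<forall>v\<in>V. col v < \<Delta> + (if (0 :: nat) = 0 then 0 else 1))"
        using r H(3) False palette_bound_large_degree[OF _ _ r0 refl, of r \<Delta>]
        by (intro ex_coloring_of_palette[OF H(1,2), where x = "sqrt (real r / (2 * real \<Delta>))" and D = \<Delta>]) auto
      then show ?thesis by simp
    qed
    then show "chi_cf V E \<le> \<Delta>" using chi_cf_le_of_palette by blast
  qed
  show ?thesis
  proof (intro exI conjI allI impI)
    show "(0 :: real) < real (max r0 3)" "(0 :: real) < 16" by auto
    show "f_cf r \<Delta> \<le> \<Delta>" if "r > 0 \<and> \<Delta> > 0 \<and> real r \<ge> real (max r0 3) \<and> real \<Delta> \<ge> 16 * ln (real r)" for r \<Delta>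
      using main[of r \<Delta>] that by simp
  qed
qed

section \<open>Moving defects in four-uniform hypergraphs\<close>

definition bad_edges :: "'a set set \<Rightarrow> ('a \<Rightarrow> nat) \<Rightarrow> 'a set set" where
  "bad_edges E col = {e\<in>E. \<not> conflict_free {e} col}"

lemma conflict_free_iff_bad_edges: "conflict_free E col \<longleftrightarrow> bad_edges E col = {}"
  unfolding bad_edges_def conflict_free_def by blast

lemma conflict_free_four:
  assumes "distinct [v, x, y, z]"
  shows "conflict_free {{v, x, y, z}} col \<longleftrightarrow>
    \<not> (col v = col x \<and> col y = col z \<or> col v = col y \<and> col x = col z \<or> col v = col z \<and> col x = col y)"
  using assms by (simp add: conflict_free_def) metis

lemma four_set_at:
  assumes "card e = 4" "v \<in> e"
  obtains x y z where "e = {v, x, y, z}" "distinct [v, x, y, z]"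
proof -
  have "card (e - {v}) = 3" using assms by (simp add: card_Diff_singleton)
  then obtain x y z where *: "e - {v} = {x, y, z}" "x \<noteq> y" "y \<noteq> z" "x \<noteq> z"
    by (auto simp: card_3_iff)
  then have "e = {v, x, y, z}" "distinct [v, x, y, z]" using assms(2) by auto
  then show thesis by (rule that)
qed

text \<open>A 4-set is bad iff it splits into two monochromatic pairs. So the colours of three vertices leave at most one bad
  colour for the fourth, namely the one that repairs the parities of the colour counts, and none if the three colours
  are distinct.\<close>
lemma forced_colour_unique:
  assumes "card e = 4" "v \<in> e"
    and "\<not> conflict_free {e} (col(v := c))" "\<not> conflict_free {e} (col(v := d))"
  shows "c = d"
proof -
  obtain x y z where e: "e = {v, x, y, z}" "distinct [v, x, y, z]"
    using four_set_at[OF assms(1,2)] .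
  show ?thesis using assms(3,4) e(2) unfolding e(1) conflict_free_four[OF e(2)] by auto
qed

lemma inj_on_three: "f x \<noteq> f y \<Longrightarrow> f x \<noteq> f z \<Longrightarrow> f y \<noteq> f z \<Longrightarrow> inj_on f {x, y, z}"
  by auto

lemma rainbow_rest_conflict_free:
  assumes "card e = 4" "v \<in> e" "inj_on col (e - {v})"
  shows "conflict_free {e} (col(v := c))"
proof -
  obtain x y z where e: "e = {v, x, y, z}" "distinct [v, x, y, z]"
    using four_set_at[OF assms(1,2)] .
  then have "e - {v} = {x, y, z}" by auto
  then show ?thesis using assms(3) e(2) unfolding e(1) conflict_free_four[OF e(2)]
    by (auto simp: inj_on_def)
qed

definition avoiding :: "'n \<Rightarrow> ('n \<times> 'n) set \<Rightarrow> ('n \<times> 'n) set" where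
  "avoiding y R = {(a, b) \<in> R. a \<noteq> y \<and> b \<noteq> y}"

text \<open>Choose \<open>K\<close> minimal among the nonempty sets of nodes with at most one outside neighbour \<open>x\<close>. Let
  \<open>y \<in> K\<close>. After deletion of \<open>y\<close>, the component of a neighbour of \<open>y\<close> must contain \<open>x\<close>: otherwise its intersection with
  \<open>K\<close> would be a smaller such set, with \<open>y\<close> as its only outside neighbour. So all neighbours of \<open>y\<close> lie in
  one component, namely that of \<open>x\<close>. The set \<open>K\<close> plays the role of a leaf block.\<close>
lemma locally_2_connected_piece:
  fixes R :: "('n \<times> 'n) set"
  assumes "finite N" "n0 \<in> N" and closed: "R `` N \<subseteq> N" and "sym R"
  shows "\<exists>K x. K \<noteq> {} \<and> K \<subseteq> N \<and> (\<forall>m n. m \<in> K \<longrightarrow> (m, n) \<in> R \<longrightarrow> n \<in> K \<or> n = x) \<and>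
    (\<forall>y a b. y \<in> K \<longrightarrow> (y, a) \<in> R \<longrightarrow> (y, b) \<in> R \<longrightarrow> a \<noteq> y \<longrightarrow> b \<noteq> y \<longrightarrow> (a, b) \<in> (avoiding y R)\<^sup>*)"
proof -
  define piece where "piece K x \<longleftrightarrow> K \<noteq> {} \<and> K \<subseteq> N \<and> (\<forall>m n. m \<in> K \<longrightarrow> (m, n) \<in> R \<longrightarrow> n \<in> K \<or> n = x)" for K x
  \<comment> \<open>The set \<open>N\<close> has no outside neighbours, so any \<open>x\<close> will do for it; hence a minimal piece exists.\<close>
  have "piece N n0" using assms(2) closed by (auto simp: piece_def)
  then have "\<exists>K. \<exists>x. piece K x" by blast
  then obtain K x where K: "piece K x" and min: "\<And>K' x'. piece K' x' \<Longrightarrow> card K \<le> card K'"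
    using ex_has_least_nat[of "\<lambda>K. \<exists>x. piece K x" _ card] by metis
  have finK: "finite K" using K assms(1) by (auto simp: piece_def intro: finite_subset)
  define A where "A y a = {b. (a, b) \<in> (avoiding y R)\<^sup>*}" for y a
  have x_in: "x \<in> A y a" if y: "y \<in> K" "(y, a) \<in> R" "a \<noteq> y" for y a
  proof (rule ccontr)
    assume x: "x \<notin> A y a"
    have "a \<in> A y a" by (simp add: A_def)
    then have aK: "a \<in> A y a \<inter> K" using K y x unfolding piece_def by blast
    have step: "n \<in> A y a" if "m \<in> A y a" "(m, n) \<in> R" "n \<noteq> y" "m \<noteq> y" for m n
      using that unfolding A_def avoiding_def by (auto intro: rtrancl.rtrancl_into_rtrancl)
    have "y \<notin> A y a"
    proof
      assume "y \<in> A y a"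
      then have "(a, y) \<in> (avoiding y R)\<^sup>*" by (simp add: A_def)
      then show False using y(3) by (cases rule: rtranclE) (auto simp: avoiding_def)
    qed
    then have "piece (A y a \<inter> K) y"
      using K aK step x unfolding piece_def by blast
    then have "card K \<le> card (A y a \<inter> K)" by (rule min)
    moreover have "A y a \<inter> K \<subset> K" using \<open>y \<notin> A y a\<close> y(1) by blast
    then have "card (A y a \<inter> K) < card K" by (rule psubset_card_mono[OF finK])
    ultimately show False by simp
  qed
  have symA: "sym ((avoiding y R)\<^sup>*)" for y
    using assms(4) by (intro sym_rtrancl) (auto simp: avoiding_def sym_def)
  have "(a, b) \<in> (avoiding y R)\<^sup>*" if "y \<in> K" "(y, a) \<in> R" "(y, b) \<in> R" "a \<noteq> y" "b \<noteq> y" for y a b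
  proof -
    have "(a, x) \<in> (avoiding y R)\<^sup>*" "(b, x) \<in> (avoiding y R)\<^sup>*"
      using x_in[of y] that by (auto simp: A_def)
    then show ?thesis using symA[of y] by (meson rtrancl_trans symD)
  qed
  then show ?thesis using K unfolding piece_def by blast
qed

text \<open>The setting of the Brooks-type argument. The number \<open>D\<close> is both the degree bound and the number of
  available colours.\<close>
locale four_uniform =
  fixes E :: "'a set set" and D :: nat
  assumes finite_E: "finite E"
    and card_edge: "\<And>e. e \<in> E \<Longrightarrow> card e = 4"
    and degree_le: "\<And>v. vertex_degree E v \<le> D"
    and D_ge_3: "3 \<le> D"
begin

text \<open>Colourings range over all of the type, so that recolouring a vertex needs no side conditions; only the values on the
  finitely many vertices of \<open>E\<close> matter.\<close>
definition optimal :: "('a \<Rightarrow> nat) \<Rightarrow> bool" where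
  "optimal col \<longleftrightarrow> (\<forall>v. col v < D) \<and>
    (\<forall>col'. (\<forall>v. col' v < D) \<longrightarrow> card (bad_edges E col) \<le> card (bad_edges E col'))"

text \<open>An optimal colouring may have several bad edges; \<open>e\<close> is the one that is being moved.\<close>
definition defect :: "('a \<Rightarrow> nat) \<Rightarrow> 'a set \<Rightarrow> bool" where
  "defect col e \<longleftrightarrow> optimal col \<and> e \<in> bad_edges E col"

text \<open>Giving \<open>v\<close> the colour \<open>c\<close> only affects the edges at \<open>v\<close>. Let \<open>F c\<close> be those that become bad. By
  optimality no \<open>F c\<close> is smaller than \<open>F (col v)\<close>, which contains \<open>e\<close>, so all are
  nonempty. They are disjoint, as an edge spoils at most one colour at \<open>v\<close>, and there are \<open>D\<close> of them among at most \<open>D\<close>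
  edges. So each is a singleton and together they exhaust the edges at \<open>v\<close>: every
  edge at \<open>v\<close> can be made the bad one, by its own colour, and the colouring remains optimal.\<close>
lemma defect_recolour:
  assumes "defect col e" "v \<in> e"
  shows edge_forces_colour: "\<And>f. f \<in> E \<Longrightarrow> v \<in> f \<Longrightarrow> \<exists>c. defect (col(v := c)) f"
    and colour_forced_once: "\<And>c f g. defect (col(v := c)) f \<Longrightarrow> f \<in> E \<Longrightarrow> g \<in> E \<Longrightarrow> v \<in> f \<Longrightarrow> v \<in> g \<Longrightarrow>
      g \<in> bad_edges E (col(v := c)) \<Longrightarrow> f = g"
    and defect_degree: "vertex_degree E v = D"
proof -
  define F where "F c = {f\<in>E. v \<in> f \<and> \<not> conflict_free {f} (col(v := c))}" for c
  define N where "N = {f\<in>bad_edges E col. v \<notin> f}"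
  have opt: "optimal col" and eE: "e \<in> E" and ebad: "\<not> conflict_free {e} col"
    using assms by (auto simp: defect_def bad_edges_def)
  have range: "\<And>u. col u < D" using opt by (simp add: optimal_def)
  have finF: "finite (F c)" "finite N" for c using finite_E by (auto simp: F_def N_def bad_edges_def)
  have "bad_edges E (col(v := c)) = N \<union> F c" for c
  proof -
    have "conflict_free {f} (col(v := c)) \<longleftrightarrow> conflict_free {f} col" if "v \<notin> f" for f
    proof -
      have "\<And>w. w \<in> f \<Longrightarrow> (col(v := c)) w = col w" using that by auto
      then show ?thesis unfolding conflict_free_def by auto
    qed
    then show ?thesis by (auto simp: bad_edges_def N_def F_def)
  qed
  moreover have "N \<inter> F c = {}" for c by (auto simp: N_def F_def)
  ultimately have card_bad: "card (bad_edges E (col(v := c))) = card N + card (F c)" for c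
    using finF by (simp add: card_Un_disjoint)
  have col_v: "col(v := col v) = col" by simp
  have F_ge: "card (F (col v)) \<le> card (F c)" if "c < D" for c
  proof -
    have "card (bad_edges E col) \<le> card (bad_edges E (col(v := c)))"
      using opt that range by (simp add: optimal_def)
    then show ?thesis using card_bad[of c] card_bad[of "col v"] unfolding col_v by simp
  qed
  have "e \<in> F (col v)" using eE assms(2) ebad by (simp add: F_def)
  then have F_pos: "1 \<le> card (F (col v))" using finF by (simp add: Suc_le_eq card_gt_0_iff) blast
  have disj: "F c \<inter> F d = {}" if "c \<noteq> d" for c d
    using forced_colour_unique card_edge that unfolding F_def by fastforce
  have F_sub: "(\<Union>c<D. F c) \<subseteq> {f\<in>E. v \<in> f}" by (auto simp: F_def)
  have "(\<Sum>c<D. card (F c)) = card (\<Union>c<D. F c)"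
    using disj finF by (subst card_UN_disjoint) auto
  moreover have "card (\<Union>c<D. F c) \<le> vertex_degree E v"
    unfolding vertex_degree_def using F_sub finite_E by (intro card_mono) auto
  ultimately have sum_le: "(\<Sum>c<D. card (F c)) \<le> vertex_degree E v" 
      and U: "card (\<Union>c<D. F c) = (\<Sum>c<D. card (F c))" by simp_all
  have "(\<Sum>c<D. 1) \<le> (\<Sum>c<D. card (F c))"
    using F_ge F_pos by (intro sum_mono) (meson le_trans lessThan_iff)
  then have "D \<le> (\<Sum>c<D. card (F c))" by simp
  then have sum_eq: "(\<Sum>c<D. card (F c)) = D" and degD: "vertex_degree E v = D"
    using sum_le degree_le[of v] by auto
  show "vertex_degree E v = D" by (rule degD)
  have F_one: "card (F c) = 1" if "c < D" for c
  proof (rule ccontr)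
    assume "card (F c) \<noteq> 1"
    then have "1 < card (F c)" using F_ge[OF that] F_pos by simp
    then have "(\<Sum>c<D. 1) < (\<Sum>c<D. card (F c))"
      using F_ge F_pos that by (intro sum_strict_mono_ex1) (auto intro: le_trans)
    then show False using sum_eq by simp
  qed
  have cover: "(\<Union>c<D. F c) = {f\<in>E. v \<in> f}"
    using F_sub finite_E U sum_eq degD
    by (intro card_subset_eq) (auto simp: vertex_degree_def)
  have opt': "optimal (col(v := c))" if "c < D" for c
  proof -
    have "card (F (col v)) = card (F c)" using F_one that range by simp
    then have "card (bad_edges E (col(v := c))) = card (bad_edges E col)"
      using card_bad[of c] card_bad[of "col v"] unfolding col_v by simp
    then show ?thesis using opt that by (simp add: optimal_def)
  qed
  show "\<exists>c. defect (col(v := c)) f" if f: "f \<in> E" "v \<in> f" for f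
  proof -
    obtain c where "c < D" "f \<in> F c" using cover f by blast
    then show ?thesis using opt' by (auto simp: defect_def bad_edges_def F_def)
  qed
  show "f = g" if "defect (col(v := c)) f" "f \<in> E" "g \<in> E" "v \<in> f" "v \<in> g"
    "g \<in> bad_edges E (col(v := c))" for c f g
  proof -
    have "c < D" using that(1) unfolding defect_def optimal_def by (metis fun_upd_same)
    then obtain h where "F c = {h}" using F_one by (meson card_1_singletonE)
    moreover have "f \<in> F c" "g \<in> F c"
      using that by (auto simp: F_def bad_edges_def defect_def)
    ultimately show ?thesis by simp
  qed
qed

lemma defect_edge: "defect col e \<Longrightarrow> e \<in> E"
  by (simp add: defect_def bad_edges_def)

text \<open>An edge whose other three colours are distinct spoils no colour at \<open>p\<close>, but every edge at a vertex of a
  bad edge spoils one. All contradictions below are obtained from this lemma or from the injectivity in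
  \<open>colour_forced_once\<close>.\<close>
lemma no_rainbow_rest:
  assumes "defect col g" "p \<in> g" "e \<in> E" "p \<in> e"
  shows "\<not> inj_on col (e - {p})"
proof
  assume "inj_on col (e - {p})"
  then have "conflict_free {e} (col(p := c))" for c
    by (intro rainbow_rest_conflict_free card_edge assms)
  then show False using edge_forces_colour[OF assms(1,2,3,4)] by (auto simp: defect_def bad_edges_def)
qed

text \<open>One step of a walk of a defect that does not recolour the vertices in \<open>X\<close>.\<close>
definition hop :: "'a set \<Rightarrow> ('a set \<times> 'a set) set" where
  "hop X = {(f, g). f \<in> E \<and> g \<in> E \<and> (\<exists>u \<in> f \<inter> g. u \<notin> X)}"

lemma sym_hop: "sym (hop X)"
  by (auto simp: hop_def sym_def)

lemma defect_walk:
  assumes "(f, g) \<in> (hop X)\<^sup>*" "defect col f"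
  shows "\<exists>col'. defect col' g \<and> (\<forall>u\<in>X. col' u = col u)"
  using assms
proof (induction rule: rtrancl_induct)
  case base
  then show ?case by blast
next
  case (step g h)
  then obtain col' where col': "defect col' g" "\<forall>u\<in>X. col' u = col u" by blast
  obtain u where u: "u \<in> g" "u \<in> h" "u \<notin> X" "h \<in> E" using step.hyps by (auto simp: hop_def)
  obtain c where "defect (col'(u := c)) h" using edge_forces_colour[OF col'(1) u(1) u(4,2)] by blast
  moreover have "\<forall>w\<in>X. (col'(u := c)) w = col w" using col'(2) u(3) by auto
  ultimately show ?case by blast
qed

text \<open>A defect can leave \<open>e\<close> through \<open>v\<close> into the edge \<open>f\<close> and walk to an edge at \<open>p\<close> without recolouring
  any other vertex of \<open>e\<close> on the way.\<close>
definition link :: "'a set \<Rightarrow> 'a \<Rightarrow> 'a set \<Rightarrow> 'a \<Rightarrow> bool" where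
  "link e v f p \<longleftrightarrow> f \<in> E \<and> f \<noteq> e \<and> v \<in> f \<and> (\<exists>g\<in>E. g \<noteq> e \<and> p \<in> g \<and> (f, g) \<in> (hop e)\<^sup>*)"

lemma link_sym:
  assumes "link e v f p"
  shows "\<exists>g. link e p g v"
proof -
  have "sym ((hop e)\<^sup>*)" by (intro sym_rtrancl sym_hop)
  then show ?thesis using assms unfolding link_def sym_def by blast
qed

lemma link_excursion:
  assumes "defect col e" "v \<in> e" "link e v f p"
  obtains c col' g where "c \<noteq> col v" "defect (col(v := c)) f" "defect col' g" "p \<in> g"
    "\<And>u. u \<in> e \<Longrightarrow> col' u = (if u = v then c else col u)"
proof -
  obtain g where f: "f \<in> E" "f \<noteq> e" "v \<in> f" and g: "g \<in> E" "p \<in> g" "(f, g) \<in> (hop e)\<^sup>*"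
    using assms(3) by (auto simp: link_def)
  obtain c where c: "defect (col(v := c)) f" using edge_forces_colour[OF assms(1,2) f(1,3)] by blast
  have "c \<noteq> col v"
  proof
    assume "c = col v"
    then have "col(v := c) = col" by simp
    then have "f = e" using colour_forced_once[OF assms(1,2) c f(1) _ f(3) assms(2)] assms(1)
      by (simp add: defect_def bad_edges_def)
    then show False using f(2) by simp
  qed
  moreover obtain col' where "defect col' g" "\<forall>u\<in>e. col' u = (col(v := c)) u"
    using defect_walk[OF g(3) c] by blast
  ultimately show thesis using that[of c col' g] c g(2) by auto
qed

definition split_defect :: "('a \<Rightarrow> nat) \<Rightarrow> 'a \<Rightarrow> 'a \<Rightarrow> 'a \<Rightarrow> 'a \<Rightarrow> bool" where
  "split_defect col v s p q \<longleftrightarrow> distinct [v, s, p, q] \<and> defect col {v, s, p, q} \<and>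
    col v = col s \<and> col p = col q \<and> col v \<noteq> col p"

text \<open>If \<open>v\<close> left with a third colour, the walk would end at \<open>u\<close> while the rest of
  \<open>{v, s, p, q}\<close> has three distinct colours, against \<open>no_rainbow_rest\<close>. So \<open>f\<close> is the edge that spoils the
  colour of \<open>p\<close> at \<open>v\<close>.\<close>
lemma forced_colour_of_cross_link:
  assumes "split_defect col v s p q" "link {v, s, p, q} v f u" "u = p \<or> u = q"
  shows "defect (col(v := col p)) f"
proof -
  let ?e = "{v, s, p, q}"
  have d: "distinct [v, s, p, q]" "defect col ?e"
    "col v = col s" "col p = col q" "col v \<noteq> col p"
    using assms(1) by (auto simp: split_defect_def)
  obtain c col' g where c: "c \<noteq> col v" "defect (col(v := c)) f" "defect col' g" "u \<in> g"
    "\<And>w. w \<in> ?e \<Longrightarrow> col' w = (if w = v then c else col w)"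
    using link_excursion[OF d(2) _ assms(2)] by blast
  have "\<not> inj_on col' (?e - {u})"
    using no_rainbow_rest[OF c(3,4) defect_edge[OF d(2)]] assms(3) by blast
  moreover have "inj_on col' (?e - {u})" if "c \<noteq> col p"
  proof -
    have ne: "s \<noteq> v" "p \<noteq> v" "q \<noteq> v" using d(1) by auto
    have "col' v = c" "col' s = col s" "col' p = col p" "col' q = col q"
      using c(5)[of v] c(5)[of s] c(5)[of p] c(5)[of q] ne by simp_all
    then have vals: "col' v = c" "col' s = col v" "col' p = col p" "col' q = col p"
      unfolding d(3) d(4) .
    from assms(3) have "?e - {u} = {v, s, q} \<or> ?e - {u} = {v, s, p}" using d(1) by auto
    then show ?thesis using vals c(1) d(5) that by (elim disjE ssubst; intro inj_on_three) simp_all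
  qed
  ultimately show ?thesis using c(2) by blast
qed

text \<open>Leaving through \<open>v\<close> and returning through \<open>p\<close> exchanges the colours of these two vertices, which pairs \<open>v\<close>
  with \<open>q\<close> and \<open>p\<close> with \<open>s\<close>.\<close>
lemma swap_along_cross_link:
  assumes "split_defect col v s p q" "link {v, s, p, q} v f p"
  shows "\<exists>col'. split_defect col' v q p s"
proof -
  let ?e = "{v, s, p, q}"
  have d: "distinct [v, s, p, q]" "defect col ?e"
    "col v = col s" "col p = col q" "col v \<noteq> col p"
    using assms(1) by (auto simp: split_defect_def)
  have e: "?e \<in> E" using defect_edge d(2) by simp
  obtain c col' g where c: "c \<noteq> col v" "defect (col(v := c)) f" "defect col' g" "p \<in> g"
    "\<And>w. w \<in> ?e \<Longrightarrow> col' w = (if w = v then c else col w)"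
    using link_excursion[OF d(2) _ assms(2)] by blast
  have ne: "s \<noteq> v" "p \<noteq> v" "q \<noteq> v" using d(1) by auto
  have "col' v = c" "col' s = col s" "col' p = col p" "col' q = col q"
    using c(5)[of v] c(5)[of s] c(5)[of p] c(5)[of q] ne by simp_all
  then have vals: "col' v = c" "col' s = col v" "col' p = col p" "col' q = col p"
    unfolding d(3) d(4) .
  have "\<not> inj_on col' (?e - {p})"
    using no_rainbow_rest[OF c(3,4) e] by blast
  moreover have "inj_on col' (?e - {p})" if "c \<noteq> col p"
  proof -
    have "?e - {p} = {v, s, q}" using d(1) by auto
    then show ?thesis using vals c(1) d(5) that by (elim ssubst; intro inj_on_three) simp_all
  qed
  ultimately have cp: "c = col p" by blast
  obtain b where b: "defect (col'(p := b)) ?e" using edge_forces_colour[OF c(3,4) e] by blast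
  then have bad: "\<not> conflict_free {?e} (col'(p := b))" by (simp add: defect_def bad_edges_def)
  have ne': "s \<noteq> p" "q \<noteq> p" using d(1) by auto
  have "b = col v"
    using bad ne ne' vals d(5) cp unfolding conflict_free_four[OF d(1)] by auto
  moreover have "{v, q, p, s} = ?e" by auto
  ultimately have "split_defect (col'(p := b)) v q p s"
    unfolding split_defect_def using b vals cp ne ne' d(1,5) by simp
  then show ?thesis by blast
qed

text \<open>Two different edges \<open>f\<close> and \<open>g\<close> at \<open>v\<close> cannot both be linked to the opposite colour class, since both
  would spoil the same colour at \<open>v\<close>. If \<open>g\<close> is linked only to the partner \<open>s\<close>, exchanging the colours of \<open>v\<close> and
  \<open>p\<close> first makes \<open>s\<close> and \<open>p\<close> both opposite to \<open>v\<close>.\<close>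
lemma two_links_contradiction:
  assumes "split_defect col v s p q" "link {v, s, p, q} v f p"
    and "link {v, s, p, q} v g u" "u \<in> {s, p, q}" "f \<noteq> g"
  shows False
proof -
  have clash: False if "split_defect col v s' p' q'" "{v, s', p', q'} = {v, s, p, q}" 
    "p' = p \<or> q' = p" "p' = u \<or> q' = u" for col s' p' q'
  proof -
    have "defect (col(v := col p')) f" "defect (col(v := col p')) g"
      using forced_colour_of_cross_link[OF that(1)] that(2,3,4) assms(2,3) by metis+
    moreover have "defect col {v, s', p', q'}" using that(1) by (simp add: split_defect_def)
    moreover have "v \<in> f" "v \<in> g" using assms(2,3) by (auto simp: link_def)
    ultimately show False
      using colour_forced_once[of col "{v, s', p', q'}" v] defect_edge assms(5)
      by (metis defect_def insertI1)
  qed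
  show False
  proof (cases "u = s")
    case True
    obtain col' where "split_defect col' v q p s" using swap_along_cross_link[OF assms(1,2)] by blast
    then show False by (rule clash) (use True in auto)
  next
    case False
    then show False using clash[OF assms(1)] assms(4) by auto
  qed
qed

text \<open>A monochromatic bad edge becomes a split one when the defect leaves through \<open>v\<close> and returns through \<open>p\<close>:
  the edge is bad again only if \<open>p\<close> takes the new colour of \<open>v\<close>.\<close>
lemma split_of_defect:
  assumes "defect col e" "v \<in> e" "p \<in> e" "v \<noteq> p" "link e v f p"
  shows "\<exists>col' v s p q. split_defect col' v s p q \<and> e = {v, s, p, q}"
proof -
  have e: "e \<in> E" using defect_edge assms(1) by simp
  obtain x y where xy: "e = {v, p, x, y}" "distinct [v, p, x, y]"
  proof -
    obtain a b c where abc: "e = {v, a, b, c}" "distinct [v, a, b, c]"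
      using four_set_at[OF card_edge[OF e] assms(2)] .
    then consider "p = a" | "p = b" | "p = c" using assms(3,4) by auto
    then show thesis
      using abc that[of b c] that[of a c] that[of a b] by cases (auto simp: insert_commute)
  qed
  have bad: "\<not> conflict_free {e} col" using assms(1) by (simp add: defect_def bad_edges_def)
  show ?thesis
  proof (cases "col v = col p \<and> col p = col x \<and> col x = col y")
    case False
    then consider "col v = col p" "col x = col y" "col v \<noteq> col x" | "col v = col x" "col p = col y" "col v \<noteq> col p"
      | "col v = col y" "col p = col x" "col v \<noteq> col p"
      using bad unfolding xy(1) conflict_free_four[OF xy(2)] by auto
    then show ?thesis
    proof cases
      case 1
      then have "split_defect col v p x y" using assms(1) xy by (simp add: split_defect_def)
      then show ?thesis using xy(1) by blast
    next
      case 2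
      moreover have "e = {v, x, p, y}" using xy by auto
      ultimately have "split_defect col v x p y" using assms(1) xy(2) by (auto simp: split_defect_def)
      then show ?thesis using \<open>e = {v, x, p, y}\<close> by blast
    next
      case 3
      moreover have "e = {v, y, p, x}" using xy by auto
      ultimately have "split_defect col v y p x" using assms(1) xy(2) by (auto simp: split_defect_def)
      then show ?thesis using \<open>e = {v, y, p, x}\<close> by blast
    qed
  next
    case True
    obtain c col' g where c: "c \<noteq> col v" "defect (col(v := c)) f" "defect col' g" "p \<in> g"
      "\<And>w. w \<in> e \<Longrightarrow> col' w = (if w = v then c else col w)"
      using link_excursion[OF assms(1,2,5)] by blast
    obtain b where b: "defect (col'(p := b)) e" using edge_forces_colour[OF c(3,4) e assms(3)] by blast
    then have bad': "\<not> conflict_free {e} (col'(p := b))" by (simp add: defect_def bad_edges_def)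
    have ne: "p \<noteq> v" "x \<noteq> v" "y \<noteq> v" "p \<noteq> x" "p \<noteq> y" using xy(2) by auto
    have "col' v = c" "col' x = col x" "col' y = col y"
      using c(5)[of v] c(5)[of x] c(5)[of y] ne unfolding xy(1) by simp_all
    moreover have "col x = col v" "col y = col v" using True by simp_all
    ultimately have vals: "col' v = c" "col' x = col v" "col' y = col v" by simp_all
    have "b = c"
      using bad' ne vals c(1) unfolding xy(1) conflict_free_four[OF xy(2)] by auto
    then have "split_defect (col'(p := b)) v p x y"
      using b ne vals c(1) xy by (simp add: split_defect_def)
    then show ?thesis using xy(1) by blast
  qed
qed

section \<open>Finding an edge with enough links\<close>

lemma split_defect_symmetries:
  assumes "split_defect col v s p q"
  shows "split_defect col s v p q" "split_defect col v s q p" "split_defect col p q v s"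
proof -
  have "{s, v, p, q} = {v, s, p, q}" "{v, s, q, p} = {v, s, p, q}" "{p, q, v, s} = {v, s, p, q}" by auto
  then show "split_defect col s v p q" "split_defect col v s q p" "split_defect col p q v s"
    using assms unfolding split_defect_def by auto
qed

text \<open>The bipartite incidence graph, with vertices \<open>Inl v\<close> and edges \<open>Inr e\<close>. Links are derived from its paths.\<close>
definition incidence :: "(('a + 'a set) \<times> ('a + 'a set)) set" where
  "incidence = {(Inl v, Inr e) | v e. e \<in> E \<and> v \<in> e} \<union> {(Inr e, Inl v) | v e. e \<in> E \<and> v \<in> e}"

lemma incidence_simps [simp]:
  "(Inl v, Inr e) \<in> incidence \<longleftrightarrow> e \<in> E \<and> v \<in> e"
  "(Inr e, Inl v) \<in> incidence \<longleftrightarrow> e \<in> E \<and> v \<in> e"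
  "(Inl u, Inl v) \<notin> incidence" "(Inr e, Inr f) \<notin> incidence"
  by (auto simp: incidence_def)

text \<open>Defects move along the incidence graph, so every edge in the component of a bad edge is bad in some optimal
  colouring. In particular, all vertices of that component have degree \<open>D\<close>.\<close>
lemma defect_reaches:
  assumes "(Inr e, n) \<in> incidence\<^sup>*" "defect col e"
  shows "\<exists>g\<in>E. (n = Inr g \<or> (\<exists>u\<in>g. n = Inl u)) \<and> (\<exists>col'. defect col' g)"
  using assms(1)
proof (induction rule: rtrancl_induct)
  case base
  then show ?case using assms(2) defect_edge by blast
next
  case (step m n)
  then obtain g where g: "g \<in> E" "m = Inr g \<or> (\<exists>u\<in>g. m = Inl u)" "\<exists>col'. defect col' g" by blast
  show ?case
  proof (cases n)
    case (Inl u)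
    then have "u \<in> g" using g(2) step.hyps(2) by auto
    then show ?thesis using g(1,3) Inl by blast
  next
    case (Inr h)
    then obtain u where u: "u \<in> g" "u \<in> h" "h \<in> E" using g(2) step.hyps(2) by auto
    obtain col' where "defect col' g" using g(3) by blast
    from edge_forces_colour[OF this u(1,3,2)] show ?thesis using u(3) Inr by blast
  qed
qed

text \<open>If no link leads from \<open>S\<close> to \<open>e - S\<close>, the edges reachable from \<open>S\<close> by walks that
  avoid \<open>e\<close> meet \<open>e\<close> only in \<open>S\<close>, so no path around \<open>e\<close> can lead from \<open>S\<close> to \<open>e - S\<close>.\<close>
lemma cross_link:
  assumes "S \<subseteq> e" "v \<in> S" "p \<in> e - S" "(Inl v, Inl p) \<in> (avoiding (Inr e) incidence)\<^sup>*"
  shows "\<exists>v\<in>S. \<exists>p\<in>e - S. \<exists>f. link e v f p"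
proof (rule ccontr)
  assume no: "\<not> ?thesis"
  define J where "J g \<longleftrightarrow> g \<in> E \<and> g \<noteq> e \<and> (\<exists>v\<in>S. \<exists>f\<in>E. f \<noteq> e \<and> v \<in> f \<and> (f, g) \<in> (hop e)\<^sup>*)" for g
  have J_meets: "u \<in> S" if "J g" "u \<in> g" "u \<in> e" for u g
    using no that unfolding J_def link_def by blast
  have "case n of Inr g \<Rightarrow> J g | Inl u \<Rightarrow> u \<in> S \<or> u \<notin> e \<and> (\<exists>g. J g \<and> u \<in> g)"
    if "(Inl v, n) \<in> (avoiding (Inr e) incidence)\<^sup>*" for n
    using that
  proof (induction rule: rtrancl_induct)
    case base
    then show ?case using assms(2) by simp
  next
    case (step m n)
    show ?case
    proof (cases n)
      case (Inl u)
      then obtain g where "m = Inr g" "u \<in> g" using step.hyps(2) by (cases m) (auto simp: avoiding_def)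
      then show ?thesis using step.IH J_meets Inl by auto
    next
      case (Inr g)
      then obtain u where u: "m = Inl u" "u \<in> g" "g \<in> E" "g \<noteq> e"
        using step.hyps(2) by (cases m) (auto simp: avoiding_def)
      consider "u \<in> S" | h where "u \<notin> e" "J h" "u \<in> h" using step.IH u(1) by auto
      then have "J g"
      proof cases
        case 1
        then show ?thesis using u unfolding J_def by blast
      next
        case 2
        then have "(h, g) \<in> hop e" using u by (auto simp: hop_def J_def)
        then show ?thesis using 2(2) u(3,4) unfolding J_def by (meson rtrancl.rtrancl_into_rtrancl)
      qed
      then show ?thesis using Inr by simp
    qed
  qed
  from this[OF assms(4)] show False using assms(3) by auto
qed

text \<open>A path from \<open>f\<close> to \<open>e\<close> that avoids \<open>v\<close> enters \<open>e\<close> through another vertex, and up to its first visit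
  to a vertex of \<open>e\<close> it is a walk as required for a link.\<close>
lemma return_link:
  assumes "v \<in> e" "v \<in> f" "f \<in> E" "f \<noteq> e" "(Inr f, Inr e) \<in> (avoiding (Inl v) incidence)\<^sup>*"
  shows "\<exists>u\<in>e - {v}. link e v f u"
proof (rule ccontr)
  assume no: "\<not> ?thesis"
  define J where "J g \<longleftrightarrow> g \<in> E \<and> g \<noteq> e \<and> (f, g) \<in> (hop e)\<^sup>*" for g
  have J_meets: "u = v" if "J g" "u \<in> g" "u \<in> e" for u g
    using no that assms(2,3,4) unfolding J_def link_def by blast
  have "case n of Inr g \<Rightarrow> J g | Inl u \<Rightarrow> u \<notin> e \<and> (\<exists>g. J g \<and> u \<in> g)"
    if "(Inr f, n) \<in> (avoiding (Inl v) incidence)\<^sup>*" for n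
    using that
  proof (induction rule: rtrancl_induct)
    case base
    then show ?case using assms(3,4) by (simp add: J_def)
  next
    case (step m n)
    show ?case
    proof (cases n)
      case (Inl u)
      then obtain g where "m = Inr g" "u \<in> g" "u \<noteq> v" using step.hyps(2) by (cases m) (auto simp: avoiding_def)
      then show ?thesis using step.IH J_meets Inl by auto
    next
      case (Inr g)
      then obtain u where u: "m = Inl u" "u \<in> g" "g \<in> E"
        using step.hyps(2) by (cases m) (auto simp: avoiding_def)
      then obtain h where h: "u \<notin> e" "J h" "u \<in> h" using step.IH by auto
      then have "(h, g) \<in> hop e" using u by (auto simp: hop_def J_def)
      then have "J g" using h(1,2) u(2,3) unfolding J_def by (auto intro: rtrancl.rtrancl_into_rtrancl)
      then show ?thesis using Inr by simp
    qed
  qed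
  from this[OF assms(5)] show False by (simp add: J_def)
qed

lemma third_edge:
  assumes "defect col e" "v \<in> e"
  shows "\<exists>h\<in>E. v \<in> h \<and> h \<noteq> f \<and> h \<noteq> g"
proof (rule ccontr)
  assume "\<not> ?thesis"
  then have "{h\<in>E. v \<in> h} \<subseteq> {f, g}" by blast
  then have "vertex_degree E v \<le> card {f, g}"
    unfolding vertex_degree_def by (intro card_mono) simp_all
  moreover have "card {f, g} \<le> 2" by (cases "f = g") simp_all
  ultimately show False using defect_degree[OF assms] D_ge_3 by simp
qed

text \<open>Take an edge \<open>f\<close> in the piece \<open>K\<close>. Its vertices are connected around \<open>f\<close>, so its defect can be made split,
  and some link joins a vertex \<open>v'\<close> of one colour class to a vertex \<open>p'\<close> of the other. At most one of the two is the
  exceptional node \<open>x\<close>; let the other one be the start of the link. As its degree is at least 3, it has a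
  further edge \<open>h\<close>, and \<open>h\<close> is linked to \<open>f\<close> because the edges at a node of \<open>K\<close> stay connected when that node is
  deleted. This contradicts \<open>two_links_contradiction\<close>.\<close>
lemma no_defect: "\<not> defect col e"
proof
  assume def0: "defect col e"
  define N where "N = {n. (Inr e, n) \<in> incidence\<^sup>*}"
  have reach: "\<exists>g\<in>E. (n = Inr g \<or> (\<exists>u\<in>g. n = Inl u)) \<and> (\<exists>col'. defect col' g)" if "n \<in> N" for n
    using defect_reaches[OF _ def0, of n] that by (simp add: N_def)
  have "N \<subseteq> Inl ` \<Union>E \<union> Inr ` E"
  proof
    fix n assume "n \<in> N"
    from reach[OF this] obtain g where "g \<in> E" "n = Inr g \<or> (\<exists>u\<in>g. n = Inl u)" by blast
    then show "n \<in> Inl ` \<Union>E \<union> Inr ` E" by auto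
  qed
  moreover have "finite (\<Union>E)" using finite_E card_edge by (intro finite_Union) (auto intro: card_ge_0_finite)
  ultimately have finN: "finite N" using finite_E by (meson finite_Un finite_imageI finite_subset)
  have N0: "Inr e \<in> N" by (simp add: N_def)
  have closed: "incidence `` N \<subseteq> N"
    unfolding N_def by (auto intro: rtrancl.rtrancl_into_rtrancl)
  have "sym incidence" by (auto simp: sym_def incidence_def)
  from locally_2_connected_piece[OF finN N0 closed this]
  obtain K x where K: "K \<noteq> {}" "K \<subseteq> N"
    and leave: "\<forall>m n. m \<in> K \<longrightarrow> (m, n) \<in> incidence \<longrightarrow> n \<in> K \<or> n = x"
    and conn: "\<forall>m a b. m \<in> K \<longrightarrow> (m, a) \<in> incidence \<longrightarrow> (m, b) \<in> incidence \<longrightarrow>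
      a \<noteq> m \<longrightarrow> b \<noteq> m \<longrightarrow> (a, b) \<in> (avoiding m incidence)\<^sup>*"
    by (elim exE conjE)
  note leave = leave[rule_format] and conn = conn[rule_format]
  have "\<exists>f. Inr f \<in> K"
  proof -
    obtain n where n: "n \<in> K" using K(1) by blast
    then have "n \<in> N" using K(2) by blast
    from reach[OF this] obtain g col' where
      g: "g \<in> E" "n = Inr g \<or> (\<exists>u\<in>g. n = Inl u)" "defect col' g" by blast
    show ?thesis
    proof (cases "n = Inr g")
      case True
      then show ?thesis using n by blast
    next
      case False
      then obtain u where u: "u \<in> g" "n = Inl u" using g(2) by blast
      \<comment> \<open>If \<open>x\<close> is a vertex node, \<open>projr x\<close> is arbitrary and the condition on \<open>h\<close> is harmless.\<close>
      obtain h where h: "h \<in> E" "u \<in> h" "h \<noteq> projr x"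
        using third_edge[OF g(3) u(1)] by blast
      then have "Inr h \<noteq> x" by auto
      then show ?thesis using leave[of n "Inr h"] n u h by auto
    qed
  qed
  then obtain f where fK: "Inr f \<in> K" by blast
  then have "Inr f \<in> N" using K(2) by blast
  from reach[OF this] obtain col where def_f: "defect col f" by blast
  have fE: "f \<in> E" using defect_edge def_f by simp
  have vK: "Inl v \<in> K \<or> Inl v = x" if "v \<in> f" for v using leave[OF fK] fE that by simp
  have cross: "\<exists>v\<in>S. \<exists>p\<in>f - S. \<exists>g. link f v g p" if "S \<subseteq> f" "v \<in> S" "p \<in> f - S" for S v p
  proof (rule cross_link[OF that])
    show "(Inl v, Inl p) \<in> (avoiding (Inr f) incidence)\<^sup>*"
      using fK fE that by (intro conn) auto
  qed
  have key: False if split: "split_defect col v s p q" and f: "f = {v, s, p, q}"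
    and lk: "link f v g p" and v: "Inl v \<in> K" for col v s p q g
  proof -
    have def: "defect col f" using split f by (simp add: split_defect_def)
    have vf: "v \<in> f" using f by simp
    obtain h where h: "h \<in> E" "v \<in> h" "h \<noteq> f" "h \<noteq> g"
      using third_edge[OF def vf] by blast
    have "(Inr h, Inr f) \<in> (avoiding (Inl v) incidence)\<^sup>*"
      using v vf h fE by (intro conn) auto
    then obtain u where u: "u \<in> f - {v}" "link f v h u"
      using return_link[OF vf, of h] h by auto
    show False
      using two_links_contradiction[OF split, of g h u] f lk u h(4) by auto
  qed
  obtain a where a: "a \<in> f" using card_edge[OF fE] by fastforce
  obtain b where b: "b \<in> f - {a}" using four_set_at[OF card_edge[OF fE] a] by auto
  obtain p g where "p \<in> f - {a}" "link f a g p" using cross[of "{a}" a b] a b by auto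
  then obtain col v s p q where split: "split_defect col v s p q" "f = {v, s, p, q}"
    using split_of_defect[OF def_f a] by blast
  have "\<exists>v'\<in>{v, s}. \<exists>p'\<in>f - {v, s}. \<exists>g. link f v' g p'"
    using cross[of "{v, s}" v p] split by (auto simp: split_defect_def)
  then obtain v' p' g where vp: "v' \<in> {v, s}" "p' \<in> {p, q}" "link f v' g p'" using split(2) by auto
  obtain s' q' where split': "split_defect col v' s' p' q'" "f = {v', s', p', q'}"
  proof -
    note sym = split_defect_symmetries[OF split(1)] split_defect_symmetries[OF split_defect_symmetries(1)[OF split(1)]]
    show thesis
      using vp(1,2) that sym split by (auto simp: insert_commute)
  qed
  show False
  proof (cases "Inl v' = x")
    case False
    then have "Inl v' \<in> K" using vK split'(2) by auto
    then show False using key[OF split' vp(3)] by simp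
  next
    case True
    moreover have "v' \<noteq> p'" using split'(1) by (simp add: split_defect_def)
    ultimately have pK: "Inl p' \<in> K" using vK[of p'] split'(2) by auto
    obtain h where "link f p' h v'" using link_sym[OF vp(3)] by blast
    then show False
      using key[OF split_defect_symmetries(3)[OF split'(1)] _ _ pK] split'(2) by (simp add: insert_commute)
  qed
qed

lemma ex_conflict_free: "\<exists>col. (\<forall>v. col v < D) \<and> conflict_free E col"
proof -
  let ?P = "\<lambda>col. \<forall>v. col v < D"
  have "?P (\<lambda>_. 0)" using D_ge_3 by simp
  then obtain col where "?P col" "\<forall>col'. ?P col' \<longrightarrow> card (bad_edges E col) \<le> card (bad_edges E col')"
    using ex_has_least_nat[of ?P "\<lambda>_. 0" "\<lambda>col. card (bad_edges E col)"] by blast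
  then have "optimal col" by (simp add: optimal_def)
  then have "bad_edges E col = {}" using no_defect unfolding defect_def by blast
  then show ?thesis using \<open>?P col\<close> conflict_free_iff_bad_edges by blast
qed

end

theorem f_cf_4_le:
  assumes "\<Delta> \<ge> 3"
  shows "f_cf 4 \<Delta> \<le> \<Delta>"
proof (rule f_cf_le)
  fix V :: "nat set" and E
  assume H: "hypergraph V E" "uniform_edges 4 E" "max_degree V E = \<Delta>"
  interpret four_uniform E \<Delta>
    using H finite_edges[OF H(1)] vertex_degree_le_max_degree[OF H(1)] assms
    by unfold_locales (auto simp: uniform_edges_def)
  obtain col where "\<forall>v. col v < \<Delta>" "conflict_free E col" using ex_conflict_free by blast
  then show "chi_cf V E \<le> \<Delta>" using chi_cf_le_of_palette by blast
qed simp

section \<open>The values and bounds of the extremal function\<close>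

theorem theorem4:
  "(\<forall>r \<Delta> :: nat. r \<ge> 2 \<and> \<Delta> \<ge> 1 \<and> (r = 2 \<or> (\<Delta> = 2 \<and> r \<notin> {3, 5})) \<longrightarrow> f_cf r \<Delta> = \<Delta> + 1) \<and>
   (\<exists>c c\<^sub>0 :: real. c > 0 \<and> c\<^sub>0 > 0 \<and>
      (\<forall>r \<Delta> :: nat. r > 0 \<and> \<Delta> > 0 \<and> real r \<ge> c \<and> real \<Delta> \<ge> c\<^sub>0 * ln (real r) \<longrightarrow> f_cf r \<Delta> \<le> \<Delta>)) \<and>
   (\<forall>\<Delta> :: nat. \<Delta> \<ge> 3 \<longrightarrow> f_cf 4 \<Delta> \<le> \<Delta>)"
proof (intro conjI)
  show "\<forall>r \<Delta> :: nat. r \<ge> 2 \<and> \<Delta> \<ge> 1 \<and> (r = 2 \<or> (\<Delta> = 2 \<and> r \<notin> {3, 5})) \<longrightarrow> f_cf r \<Delta> = \<Delta> + 1"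
    using f_cf_eq by blast
qed (use f_cf_le_of_log_degree f_cf_4_le in blast)+

end
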